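(* Let $\alpha\in\mathbb{R}$ be given with a rational approximation $\alpha=\frac aq+\beta$, where $a\in\mathbb{Z}$, $q\ge1$, $(a,q)=1$ and $q^2|\beta|\le1$. For $N\ge2$, $R\ge1$ and any $\varepsilon>0$, we have $$\sum_{r\le R}|S(r\alpha;N)|\ll_\varepsilon\frac{RN}{\sqrt{\log N}}\left(\frac{1}{\sqrt q}+\frac{\sqrt q}{\sqrt{RN}}+\frac{1}{R^{1/3}N^{1/6}}+\frac{R^{1/3}}{N^{1/3}}\right)N^\varepsilon.$$
   Context: $\mathfrak{B}$ is the set of odd positive integers that are sums of two coprime squares (equivalently, odd positive integers with no prime factor $\equiv3\pmod4$), $b$ its characteristic function, $e(x)=e^{2\pi ix}$ and $S(\alpha;N)=\sum_{n\le N}b(n)e(n\alpha)$. The sum over $r$ is over positive integers. *)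

theory Defs
  imports Complex_Main
begin

definition BB :: "nat set" where
  "BB = {n. n > 0 \<and> odd n \<and> (\<exists>x y :: int. coprime x y \<and> int n = x\<^sup>2 + y\<^sup>2)}"

definition b_char :: "nat \<Rightarrow> complex" where
  "b_char n = of_bool (n \<in> BB)"

definition e_char :: "real \<Rightarrow> complex" where
  "e_char x = exp (2 * of_real pi * \<i> * of_real x)"

definition S_sum :: "real \<Rightarrow> real \<Rightarrow> complex" where
  "S_sum \<alpha> N = (\<Sum>n | 0 < n \<and> real n \<le> N. b_char n * e_char (real n * \<alpha>))"

end

theory Submission
  imports Defs "HOL-Analysis.Harmonic_Numbers" "HOL-Analysis.Convex" "HOL-Analysis.L2_Norm"
    "HOL-Number_Theory.Euler_Criterion" "HOL-Computational_Algebra.Squarefree"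
begin

text \<open>
  Every \<open>n \<equiv> 1\<close> modulo 4 has an even number of prime factors congruent to 3 modulo 4, so
  for \<open>n \<le> N\<close> membership in \<open>BB\<close> is detected by sieving with the primes
  \<open>p \<equiv> 3\<close> modulo 4 with \<open>p\<^sup>2 \<le> N\<close>. Pairing \<open>d\<close> with \<open>s d\<close>, where \<open>s\<close> is
  the least sieving prime of \<open>n\<close>, writes the indicator as a divisor sum over \<open>d \<le> X\<close> plus
  a sum over factorisations \<open>n = u w\<close> with \<open>X < u \<le> X\<^sup>2\<close>, subject to the condition that the
  least sieving prime of \<open>u\<close> does not exceed that of \<open>w\<close>; here \<open>N \<le> X\<^sup>4\<close> makes \<open>u\<close>
  stay below \<open>X\<^sup>2\<close>. The first part is a sum of geometric series. In the second part that
  condition and \<open>u w \<le> N\<close> are separated by finite Fourier analysis at a logarithmic cost,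
  and \<open>r u = l\<close> is treated as one variable in Cauchy's inequality, the multiplicities being
  controlled by the mean square of the divisor function. Both parts reduce to Vinogradov's bound
  for the sum over \<open>l \<le> L\<close> of the minimum of \<open>Z / l\<close> and the reciprocal distance of
  \<open>l \<alpha>\<close> to the nearest integer. The choice \<open>X = (N / R) powr (1/3) + N powr (1/4)\<close>
  balances the terms, and the logarithms are absorbed into \<open>N powr \<epsilon>\<close>.
\<close>

section \<open>Exponential sums over progressions\<close>

lemma e_char_eq_cis: "e_char x = cis (2 * pi * x)"
  by (simp add: e_char_def cis_conv_exp mult_ac)

lemma norm_e_char [simp]: "cmod (e_char x) = 1"
  by (simp add: e_char_eq_cis)

lemma e_char_add: "e_char (x + y) = e_char x * e_char y"
  by (simp add: e_char_eq_cis cis_mult distrib_left)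

lemma e_char_uminus: "e_char (- x) = cnj (e_char x)"
  by (simp add: e_char_eq_cis cis_cnj)

lemma e_char_of_nat_mult: "e_char (real k * x) = e_char x ^ k"
  by (simp add: e_char_eq_cis Complex.DeMoivre mult.left_commute)

lemma e_char_of_int [simp]: "e_char (of_int k) = 1"
  by (simp add: e_char_eq_cis)

definition nint_dist :: "real \<Rightarrow> real" where
  "nint_dist x = \<bar>x - of_int (round x)\<bar>"

lemma nint_dist_nonneg [simp]: "0 \<le> nint_dist x"
  by (simp add: nint_dist_def)

lemma nint_dist_le: "nint_dist x \<le> \<bar>x - of_int m\<bar>"
  unfolding nint_dist_def by (rule round_diff_minimal)

lemma nint_dist_eq_min_frac: "nint_dist x = min (frac x) (1 - frac x)"
proof (rule antisym)
  show "nint_dist x \<le> min (frac x) (1 - frac x)"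
    using nint_dist_le[of x "\<lfloor>x\<rfloor>"] nint_dist_le[of x "\<lfloor>x\<rfloor> + 1"]
      frac_ge_0[of x] frac_lt_1[of x]
    unfolding frac_def by simp
  show "min (frac x) (1 - frac x) \<le> nint_dist x"
  proof (cases "round x \<le> \<lfloor>x\<rfloor>")
    case True
    hence "real_of_int (round x) \<le> of_int \<lfloor>x\<rfloor>" by simp
    thus ?thesis unfolding nint_dist_def frac_def by linarith
  next
    case False
    hence "of_int \<lfloor>x\<rfloor> + 1 \<le> real_of_int (round x)" by linarith
    thus ?thesis unfolding nint_dist_def frac_def by linarith
  qed
qed

lemma nint_dist_uminus: "nint_dist (- x) = nint_dist x"
proof (rule antisym)
  show "nint_dist (- x) \<le> nint_dist x" for x
    using nint_dist_le[of "- x" "- round x"] by (simp add: nint_dist_def abs_minus_commute)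
  from this[of "- x"] show "nint_dist x \<le> nint_dist (- x)" by simp
qed

lemma two_mult_le_sin_pi:
  assumes "0 \<le> x" "x \<le> 1/2"
  shows "2 * x \<le> sin (pi * x)"
proof -
  have "convex_on {0..pi} (\<lambda>x::real. - sin x)"
  proof (rule f''_ge0_imp_convex)
    show "((\<lambda>x. - sin x) has_real_derivative - cos x) (at x)" for x
      by (auto intro!: derivative_eq_intros)
    show "((\<lambda>x. - cos x) has_real_derivative sin x) (at x)" for x
      by (auto intro!: derivative_eq_intros)
  qed (auto intro: sin_ge_zero)
  from convex_onD[OF this, of "2 * x" 0 "pi / 2"] assms show ?thesis
    by (simp add: mult_ac)
qed

lemma nint_dist_le_norm_e_char_diff: "4 * nint_dist x \<le> cmod (e_char x - 1)"
proof -
  define y where "y = x - of_int (round x)"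
  have "e_char x = e_char (of_int (round x) + y)"
    by (simp add: y_def)
  also have "\<dots> = e_char y"
    by (simp only: e_char_add e_char_of_int mult_1)
  also have "e_char y - 1 = 2 * \<i> * of_real (sin (pi * y)) * cis (pi * y)"
    using sin_double[of "pi * y"] cos_double_sin[of "pi * y"]
    by (simp add: e_char_eq_cis complex_eq_iff power2_eq_square mult_ac)
  finally have "cmod (e_char x - 1) = 2 * \<bar>sin (pi * y)\<bar>"
    by (simp add: norm_mult)
  moreover have "\<bar>sin (pi * y)\<bar> = \<bar>sin (pi * \<bar>y\<bar>)\<bar>"
    by (simp add: abs_if)
  moreover have "2 * \<bar>y\<bar> \<le> sin (pi * \<bar>y\<bar>)"
    using of_int_round_abs_le[of x]
    by (intro two_mult_le_sin_pi) (auto simp: y_def abs_minus_commute)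
  ultimately show ?thesis
    unfolding nint_dist_def y_def by linarith
qed

definition geom_bound :: "real \<Rightarrow> real \<Rightarrow> real" where
  "geom_bound Z x = (if nint_dist x = 0 then Z else min Z (1 / (2 * nint_dist x)))"

lemma geom_bound_le: "geom_bound Z x \<le> Z"
  by (simp add: geom_bound_def)

lemma geom_bound_nonneg: "0 \<le> Z \<Longrightarrow> 0 \<le> geom_bound Z x"
  by (simp add: geom_bound_def)

lemma geom_bound_mono: "Z \<le> Z' \<Longrightarrow> geom_bound Z x \<le> geom_bound Z' x"
  by (auto simp: geom_bound_def)

lemma geom_bound_uminus: "geom_bound Z (- x) = geom_bound Z x"
  by (simp add: geom_bound_def nint_dist_uminus)

lemma geom_bound_le_inverse:
  assumes "0 < a" "a \<le> frac x" "0 < b" "b \<le> 1 - frac x"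
  shows "geom_bound Z x \<le> 1 / (2 * a) + 1 / (2 * b)"
proof -
  have min_le: "min a b \<le> nint_dist x"
    using assms unfolding nint_dist_eq_min_frac by linarith
  hence pos: "0 < nint_dist x"
    using assms by linarith
  have "1 / (2 * nint_dist x) \<le> 1 / (2 * min a b)"
    using min_le pos assms by (intro divide_left_mono mult_pos_pos) auto
  also have "\<dots> \<le> 1 / (2 * a) + 1 / (2 * b)"
    using assms by (simp add: min_def)
  finally show ?thesis
    using pos by (simp add: geom_bound_def)
qed

lemma norm_geometric_sum_le:
  "cmod (\<Sum>k<n. e_char (c + real k * x)) \<le> geom_bound (real n) x"
proof -
  have norm_eq: "cmod (\<Sum>k<n. e_char (c + real k * x)) = cmod (\<Sum>k<n. e_char x ^ k)"
    by (simp add: e_char_add e_char_of_nat_mult norm_mult flip: sum_distrib_left)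
  have trivial: "cmod (\<Sum>k<n. e_char x ^ k) \<le> real n"
    using sum_norm_le[of "{..<n}" "\<lambda>k. e_char x ^ k" "\<lambda>_. 1"] by (simp add: norm_power)
  show ?thesis
  proof (cases "nint_dist x = 0")
    case False
    hence pos: "0 < 4 * nint_dist x"
      using nint_dist_nonneg[of x] by linarith
    hence "e_char x \<noteq> 1"
      using nint_dist_le_norm_e_char_diff[of x] by auto
    hence "cmod (\<Sum>k<n. e_char x ^ k) = cmod (e_char x ^ n - 1) / cmod (e_char x - 1)"
      by (simp add: geometric_sum norm_divide)
    also have "\<dots> \<le> 2 / (4 * nint_dist x)"
      using norm_triangle_ineq4[of "e_char x ^ n" 1] pos nint_dist_le_norm_e_char_diff[of x]
      by (intro frac_le) (auto simp: norm_power)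
    finally show ?thesis
      using trivial False by (simp add: geom_bound_def norm_eq)
  qed (use trivial in \<open>simp add: geom_bound_def norm_eq\<close>)
qed

lemma less_div_iff_mult_add_le:
  fixes c m :: nat
  assumes "0 < c" "c < m"
  shows "k < (N + m - c) div m \<longleftrightarrow> m * k + c \<le> N"
proof -
  have "k < (N + m - c) div m \<longleftrightarrow> Suc k * m \<le> N + m - c"
    using assms by (simp add: less_eq_div_iff_mult_less_eq flip: Suc_le_eq)
  also have "\<dots> \<longleftrightarrow> m * k + c \<le> N"
    using assms by (auto simp: algebra_simps)
  finally show ?thesis .
qed

lemma norm_progression_sum_le:
  assumes "0 < c" "c < m"
  shows "cmod (\<Sum>n=1..N. of_bool (n mod m = c) * e_char (real n * x))
    \<le> geom_bound (real N) (real m * x)"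
proof -
  define K where "K = (N + m - c) div m"
  note less_K_iff = less_div_iff_mult_add_le[OF assms, of _ N, folded K_def]
  have "(\<Sum>n=1..N. of_bool (n mod m = c) * e_char (real n * x))
      = (\<Sum>n\<in>{n \<in> {1..N}. n mod m = c}. e_char (real n * x))"
    unfolding sum.inter_filter[OF finite_atLeastAtMost] by (intro sum.cong) auto
  also have "\<dots> = (\<Sum>k<K. e_char (real (m * k + c) * x))"
  proof (rule sum.reindex_bij_witness[of _ "\<lambda>k. m * k + c" "\<lambda>n. n div m"])
    fix n assume n: "n \<in> {n \<in> {1..N}. n mod m = c}"
    thus n_eq: "m * (n div m) + c = n" by auto
    show "n div m \<in> {..<K}" using n less_K_iff[of "n div m"] by (simp add: n_eq)
    show "e_char (real (m * (n div m) + c) * x) = e_char (real n * x)" by (simp only: n_eq)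
  qed (use assms in \<open>auto simp: less_K_iff\<close>)
  also have "\<dots> = (\<Sum>k<K. e_char (real c * x + real k * (real m * x)))"
    by (intro sum.cong arg_cong[of _ _ e_char]) (auto simp: algebra_simps)
  also have "cmod \<dots> \<le> geom_bound (real K) (real m * x)"
    by (rule norm_geometric_sum_le)
  also have "\<dots> \<le> geom_bound (real N) (real m * x)"
  proof (rule geom_bound_mono)
    have "N \<le> m * N" using assms by simp
    hence "\<not> m * N + c \<le> N" using assms by linarith
    thus "real K \<le> real N" using less_K_iff[of N] by simp
  qed
  finally show ?thesis .
qed

lemma norm_interval_sum_le: "cmod (\<Sum>l=1..L. e_char (real l * x)) \<le> geom_bound (real L) x"
proof -
  have "(\<Sum>l=1..L. e_char (real l * x)) = (\<Sum>k<L. e_char (x + real k * x))"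
    by (rule sum.reindex_bij_witness[of _ Suc "\<lambda>l. l - 1"]) (auto simp: algebra_simps)
  thus ?thesis by (simp add: norm_geometric_sum_le)
qed

section \<open>Vinogradov's lemma\<close>

definition bin_index :: "nat \<Rightarrow> real \<Rightarrow> nat" where
  "bin_index M x = nat \<lfloor>real M * frac x\<rfloor>"

lemma bin_index_le: "real (bin_index M x) \<le> real M * frac x"
  and less_bin_index_plus_1: "real M * frac x < real (bin_index M x) + 1"
proof -
  have "0 \<le> real M * frac x" by simp
  thus "real (bin_index M x) \<le> real M * frac x" "real M * frac x < real (bin_index M x) + 1"
    unfolding bin_index_def by linarith+
qed

lemma bin_index_less:
  assumes "M > 0"
  shows "bin_index M x < M"
proof -
  have "real M * frac x < real M"
    using assms frac_lt_1[of x] by simp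
  thus ?thesis
    using bin_index_le[of M x] by linarith
qed

lemma nint_dist_less_if_bin_index_eq:
  assumes "M > 0" "bin_index M x = bin_index M y"
  shows "nint_dist (x - y) < 1 / real M"
proof -
  have "\<bar>real M * (frac x - frac y)\<bar> < 1"
    unfolding right_diff_distrib
    using bin_index_le[of M x] less_bin_index_plus_1[of M x] bin_index_le[of M y]
      less_bin_index_plus_1[of M y] assms(2) by linarith
  hence "\<bar>frac x - frac y\<bar> < 1 / real M"
    using assms(1) by (simp add: abs_mult less_divide_eq mult.commute)
  moreover have "nint_dist (x - y) \<le> \<bar>frac x - frac y\<bar>"
    using nint_dist_le[of "x - y" "\<lfloor>x\<rfloor> - \<lfloor>y\<rfloor>"] by (simp add: frac_def algebra_simps)
  ultimately show ?thesis by linarith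
qed

lemma nint_dist_le_if_outer_bin:
  assumes "M > 0" "bin_index M x = 0 \<or> bin_index M x = M - 1"
  shows "nint_dist x \<le> 1 / real M"
proof -
  have "real M * frac x \<le> 1 \<or> real M * (1 - frac x) \<le> 1"
    using assms bin_index_le[of M x] less_bin_index_plus_1[of M x]
    by (auto simp: of_nat_diff right_diff_distrib)
  hence "frac x \<le> 1 / real M \<or> 1 - frac x \<le> 1 / real M"
    using assms(1) by (simp add: field_simps)
  thus ?thesis by (auto simp: nint_dist_eq_min_frac)
qed

definition bin_bound :: "nat \<Rightarrow> real \<Rightarrow> nat \<Rightarrow> real" where
  "bin_bound M Z k =
     (if k = 0 \<or> k = M - 1 then Z else real M / 2 * (1 / real k + 1 / real (M - 1 - k)))"

lemma geom_bound_le_bin_bound: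
  assumes "M > 0" "nint_dist x \<le> 1 / real M \<Longrightarrow> Y \<le> Z"
  shows "geom_bound Y x \<le> bin_bound M Z (bin_index M x)"
proof (cases "bin_index M x = 0 \<or> bin_index M x = M - 1")
  case True
  hence "Y \<le> Z"
    using nint_dist_le_if_outer_bin[of M x] assms by blast
  thus ?thesis
    using True geom_bound_le[of Y x] by (simp add: bin_bound_def)
next
  case False
  define k where "k = bin_index M x"
  have k_inner: "0 < k" "k < M - 1"
    using False bin_index_less[OF assms(1), of x] by (auto simp: k_def)
  have "geom_bound Y x \<le> 1 / (2 * (real k / real M)) + 1 / (2 * (real (M - 1 - k) / real M))"
  proof (rule geom_bound_le_inverse)
    show "real k / real M \<le> frac x"
      using bin_index_le[of M x] assms(1) by (simp add: k_def field_simps)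
    show "real (M - 1 - k) / real M \<le> 1 - frac x"
      using less_bin_index_plus_1[of M x] assms(1) k_inner
      by (simp add: k_def field_simps of_nat_diff)
  qed (use k_inner assms(1) in auto)
  also have "\<dots> = real M / 2 * (1 / real k + 1 / real (M - 1 - k))"
    by (simp add: field_simps)
  finally show ?thesis
    using False by (simp add: bin_bound_def k_def)
qed

lemma bin_bound_nonneg: "0 \<le> Z \<Longrightarrow> 0 \<le> bin_bound M Z k"
  by (simp add: bin_bound_def)

lemma sum_bin_bound_le:
  assumes "M > 0" "Z \<ge> 0"
  shows "(\<Sum>k<M. bin_bound M Z k) \<le> 2 * Z + real M * harm M"
proof -
  let ?inner = "{1..<M - 1}"
  have inner_bound: "bin_bound M Z k = real M / 2 * (1 / real k + 1 / real (M - 1 - k))"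
    if "k \<in> ?inner" for k
    using that by (auto simp: bin_bound_def)
  have "(\<Sum>k<M. bin_bound M Z k)
      = (\<Sum>k\<in>{0, M - 1}. bin_bound M Z k) + (\<Sum>k\<in>?inner. bin_bound M Z k)"
    using assms(1) by (subst sum.union_disjoint[symmetric]) (auto intro!: sum.cong)
  also have "(\<Sum>k\<in>{0, M - 1}. bin_bound M Z k) \<le> (\<Sum>k\<in>{0, M - 1}. Z)"
    by (intro sum_mono) (auto simp: bin_bound_def)
  also have "\<dots> \<le> 2 * Z"
    using assms by (simp add: card_insert_if)
  also have "(\<Sum>k\<in>?inner. bin_bound M Z k)
      = real M / 2 * ((\<Sum>k\<in>?inner. 1 / real k) + (\<Sum>k\<in>?inner. 1 / real (M - 1 - k)))"
    by (simp only: inner_bound sum.distrib flip: sum_distrib_left cong: sum.cong)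
  also have "(\<Sum>k\<in>?inner. 1 / real (M - 1 - k)) = (\<Sum>k\<in>?inner. 1 / real k)"
    by (rule sum.reindex_bij_witness[of _ "\<lambda>k. M - 1 - k" "\<lambda>k. M - 1 - k"]) auto
  also have "real M / 2 * ((\<Sum>k\<in>?inner. 1 / real k) + (\<Sum>k\<in>?inner. 1 / real k))
      = real M * (\<Sum>k\<in>?inner. 1 / real k)"
    by simp
  also have "(\<Sum>k\<in>?inner. 1 / real k) \<le> harm M"
    unfolding harm_def inverse_eq_divide by (intro sum_mono2) auto
  finally show ?thesis by (simp add: mult_left_mono)
qed

lemma sum_geom_bound_well_spaced_le:
  fixes x :: "'a \<Rightarrow> real"
  assumes "M > 0" "Z \<ge> 0"
    and spaced: "\<And>i j. i \<in> I \<Longrightarrow> j \<in> I \<Longrightarrow> i \<noteq> j \<Longrightarrow> 1 / real M \<le> nint_dist (x i - x j)"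
    and cap: "\<And>i. i \<in> I \<Longrightarrow> nint_dist (x i) \<le> 1 / real M \<Longrightarrow> Y i \<le> Z"
  shows "(\<Sum>i\<in>I. geom_bound (Y i) (x i)) \<le> 2 * Z + real M * harm M"
proof -
  have "inj_on (\<lambda>i. bin_index M (x i)) I"
    using nint_dist_less_if_bin_index_eq[OF assms(1)] spaced by (meson inj_onI not_less)
  hence "(\<Sum>i\<in>I. bin_bound M Z (bin_index M (x i)))
      = (\<Sum>k\<in>(\<lambda>i. bin_index M (x i)) ` I. bin_bound M Z k)"
    by (simp add: sum.reindex)
  also have "\<dots> \<le> (\<Sum>k<M. bin_bound M Z k)"
    using bin_index_less[OF assms(1)] assms(2) by (intro sum_mono2) (auto intro: bin_bound_nonneg)
  also have "\<dots> \<le> 2 * Z + real M * harm M"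
    using assms(1,2) by (rule sum_bin_bound_le)
  finally have bin_sum_le: "(\<Sum>i\<in>I. bin_bound M Z (bin_index M (x i))) \<le> 2 * Z + real M * harm M" .
  have "(\<Sum>i\<in>I. geom_bound (Y i) (x i)) \<le> (\<Sum>i\<in>I. bin_bound M Z (bin_index M (x i)))"
    using assms(1) cap by (intro sum_mono geom_bound_le_bin_bound)
  with bin_sum_le show ?thesis by linarith
qed

lemma sum_divide_multiples: "(\<Sum>j\<le>J. Z / (real j * h)) = Z / h * harm J"
proof -
  have "{..J} = insert 0 {1..J}" by auto
  thus ?thesis by (simp add: harm_def sum_distrib_left divide_inverse mult_ac)
qed

lemma one_le_harm: "n \<ge> 1 \<Longrightarrow> 1 \<le> (harm n :: real)"
  using harm_mono[of 1 n, where ?'a = real] by (simp add: harm_expand)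

locale rational_approx =
  fixes \<alpha> \<beta> :: real and a :: int and q :: nat
  assumes q_ge_1: "q \<ge> 1" and coprime: "coprime a (int q)"
    and approx: "\<alpha> = of_int a / real q + \<beta>" and beta_le: "(real q)\<^sup>2 * \<bar>\<beta>\<bar> \<le> 1"
begin

lemma nint_dist_multiple_gt:
  fixes d :: int
  assumes "d \<noteq> 0" "2 * \<bar>d\<bar> < q"
  shows "1 / (2 * real q) < nint_dist (of_int d * \<alpha>)"
proof -
  define t where "t = round (of_int d * \<alpha>)"
  have q_pos: "real q > 0" using q_ge_1 by simp
  have "\<not> int q dvd d"
    using assms zdvd_imp_le[of "int q" "\<bar>d\<bar>"] by auto
  hence "\<not> int q dvd d * a"
    using coprime by (simp add: coprime_commute coprime_dvd_mult_left_iff)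
  hence "d * a - t * int q \<noteq> 0"
    by (metis dvd_triv_right eq_iff_diff_eq_0)
  hence "1 \<le> \<bar>real_of_int (d * a - t * int q)\<bar>"
    by linarith
  also have "real_of_int (d * a - t * int q) = real q * (of_int d * \<alpha> - of_int t - of_int d * \<beta>)"
    using q_pos by (simp add: approx field_simps)
  also have "\<bar>\<dots>\<bar> \<le> real q * (nint_dist (of_int d * \<alpha>) + \<bar>of_int d\<bar> * \<bar>\<beta>\<bar>)"
    using abs_triangle_ineq4[of "of_int d * \<alpha> - of_int t" "of_int d * \<beta>"]
    by (simp add: abs_mult nint_dist_def t_def mult_left_mono)
  finally have "1 \<le> real q * nint_dist (of_int d * \<alpha>) + real q * \<bar>of_int d\<bar> * \<bar>\<beta>\<bar>"
    by (simp add: distrib_left mult.assoc)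
  moreover have "real q * \<bar>of_int d\<bar> * \<bar>\<beta>\<bar> < 1 / 2"
  proof (cases "\<beta> = 0")
    case False
    have "2 * \<bar>real_of_int d\<bar> < real q"
      using assms(2) by linarith
    hence "2 * \<bar>real_of_int d\<bar> * (real q * \<bar>\<beta>\<bar>) < real q * (real q * \<bar>\<beta>\<bar>)"
      using False q_pos by (intro mult_strict_right_mono) auto
    thus ?thesis using beta_le by (simp add: power2_eq_square mult_ac)
  qed simp
  ultimately have "1 / 2 < real q * nint_dist (of_int d * \<alpha>)"
    by linarith
  thus ?thesis using q_pos by (simp add: field_simps)
qed

definition block_length :: nat where
  "block_length = (q + 1) div 2"

lemma block_length_pos: "0 < block_length"
  and q_le_block_length: "q \<le> 2 * block_length"
  and block_length_le: "2 * block_length \<le> q + 1"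
  using q_ge_1 by (auto simp: block_length_def)

(* For j = 0 the quotient Z / 0 is 0, as no l \<alpha> with 0 < l < block_length is close to an integer. *)
lemma block_sum_le:
  assumes "Z \<ge> 0" and in_block: "\<And>l. l \<in> I \<Longrightarrow> 0 < l \<and> l div block_length = j"
  shows "(\<Sum>l\<in>I. geom_bound (Z / real l) (real l * \<alpha>))
     \<le> 2 * (Z / (real j * real block_length)) + 2 * real q * harm (2 * q)"
proof -
  define s where "s = j * block_length"
  have block: "s \<le> l" "l < s + block_length" if "l \<in> I" for l
    using in_block[OF that] block_length_pos dividend_less_div_times[of block_length l]
    by (auto simp: s_def div_times_less_eq_dividend add.commute)
  have "(\<Sum>l\<in>I. geom_bound (Z / real l) (real l * \<alpha>))
      \<le> 2 * (Z / (real j * real block_length)) + real (2 * q) * harm (2 * q)"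
  proof (rule sum_geom_bound_well_spaced_le)
    fix l l' assume l: "l \<in> I" "l' \<in> I" "l \<noteq> l'"
    have "\<bar>int l - int l'\<bar> < int block_length"
      using block[OF l(1)] block[OF l(2)] by (auto simp: abs_less_iff)
    hence "2 * \<bar>int l - int l'\<bar> < int q"
      using of_nat_mono[OF block_length_le, where ?'a = int] by simp
    thus "1 / real (2 * q) \<le> nint_dist (real l * \<alpha> - real l' * \<alpha>)"
      using nint_dist_multiple_gt[of "int l - int l'"] l(3) by (simp add: left_diff_distrib)
  next
    fix l assume l: "l \<in> I" "nint_dist (real l * \<alpha>) \<le> 1 / real (2 * q)"
    have "0 < j"
    proof (rule ccontr)
      assume "\<not> 0 < j"
      hence "2 * \<bar>int l\<bar> < int q" "l \<noteq> 0"
        using block[OF l(1)] in_block[OF l(1)] block_length_le by (auto simp: s_def)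
      thus False
        using nint_dist_multiple_gt[of "int l"] l(2) by simp
    qed
    moreover have "real j * real block_length \<le> real l"
      using block(1)[OF l(1)] unfolding s_def by (metis of_nat_le_iff of_nat_mult)
    ultimately show "Z / real l \<le> Z / (real j * real block_length)"
      using assms(1) block_length_pos in_block[OF l(1)]
      by (intro divide_left_mono mult_pos_pos) auto
  qed (use q_ge_1 assms(1) in auto)
  thus ?thesis by simp
qed

lemma vinogradov_sum_le:
  assumes "Z \<ge> 0" "2 * q \<le> M" "L \<le> M"
  shows "(\<Sum>l=1..L. geom_bound (Z / real l) (real l * \<alpha>)) \<le> 4 * harm M * (Z / q + L + q)"
proof -
  define J where "J = L div block_length"
  have q_pos: "real q > 0" and length: "real block_length > 0" "real q \<le> 2 * real block_length"
    using q_ge_1 block_length_pos q_le_block_length by auto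
  have "real J * real q \<le> real J * (2 * real block_length)"
    using length by (intro mult_left_mono) auto
  also have "\<dots> \<le> 2 * real L"
    using of_nat_div_le_of_nat[of L block_length, where ?'a = real] length(1)
    by (simp add: J_def le_divide_eq)
  finally have J_q_le: "real J * real q \<le> 2 * real L" .
  have "J \<le> M"
    using assms(3) div_le_dividend[of L block_length] unfolding J_def by linarith
  hence harm_J: "harm J \<le> (harm M :: real)" by (rule harm_mono)
  have harm_q: "harm (2 * q) \<le> (harm M :: real)" using assms(2) by (rule harm_mono)
  have "(\<Sum>l=1..L. geom_bound (Z / real l) (real l * \<alpha>))
      = (\<Sum>j\<le>J. \<Sum>l\<in>{l \<in> {1..L}. l div block_length = j}.
          geom_bound (Z / real l) (real l * \<alpha>))"
    unfolding J_def by (rule sum.group[symmetric]) (auto intro: div_le_mono)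
  also have "\<dots> \<le> (\<Sum>j\<le>J. 2 * (Z / (real j * real block_length)) + 2 * real q * harm (2 * q))"
    using assms(1) by (intro sum_mono block_sum_le) auto
  also have "\<dots> = 2 * (\<Sum>j\<le>J. Z / (real j * real block_length))
      + real (J + 1) * (2 * real q * harm (2 * q))"
    by (simp add: sum.distrib sum_distrib_left)
  also have "\<dots> = 2 * (Z / real block_length) * harm J
      + 2 * (real J * real q + real q) * harm (2 * q)"
    by (simp add: sum_divide_multiples algebra_simps)
  also have "\<dots> \<le> 2 * (2 * (Z / q)) * harm M + 2 * (2 * real L + real q) * harm M"
  proof -
    have "2 * (Z / real block_length) \<le> 2 * (2 * (Z / q))"
      using mult_left_mono[OF length(2) assms(1)] length(1) q_pos by (simp add: field_simps)
    thus ?thesis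
      using J_q_le assms(1) q_pos
      by (intro add_mono[OF mult_mono[OF _ harm_J] mult_mono[OF _ harm_q]]) (auto simp: harm_nonneg)
  qed
  also have "\<dots> \<le> 4 * harm M * (Z / q + L + q)"
    by (simp add: algebra_simps harm_nonneg)
  finally show ?thesis .
qed

end

section \<open>Divisor sums and mean squares\<close>

definition divisor_count :: "nat \<Rightarrow> nat" where
  "divisor_count n = card {d. d dvd n}"

lemma sum_products_le_sum_divisor_count:
  fixes \<phi> :: "nat \<Rightarrow> real"
  assumes "\<And>l. \<phi> l \<ge> 0"
  shows "(\<Sum>r=1..R. \<Sum>d=1..D. \<phi> (r * d)) \<le> (\<Sum>l=1..R*D. real (divisor_count l) * \<phi> l)"
proof -
  let ?P = "{1..R} \<times> {1..D}"
  have "(\<Sum>r=1..R. \<Sum>d=1..D. \<phi> (r * d)) = (\<Sum>p\<in>?P. \<phi> (fst p * snd p))"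
    by (simp add: sum.cartesian_product case_prod_beta)
  also have "\<dots> = (\<Sum>l=1..R*D. \<Sum>p\<in>{p\<in>?P. fst p * snd p = l}. \<phi> (fst p * snd p))"
    by (rule sum.group[symmetric]) (auto intro: mult_le_mono)
  also have "\<dots> = (\<Sum>l=1..R*D. real (card {p\<in>?P. fst p * snd p = l}) * \<phi> l)"
    by (intro sum.cong) auto
  also have "\<dots> \<le> (\<Sum>l=1..R*D. real (divisor_count l) * \<phi> l)"
  proof (intro sum_mono mult_right_mono)
    fix l assume l: "l \<in> {1..R*D}"
    have "card {p\<in>?P. fst p * snd p = l} \<le> divisor_count l"
      unfolding divisor_count_def
    proof (rule card_inj_on_le[of snd])
      show "inj_on snd {p\<in>?P. fst p * snd p = l}"
        by (auto simp: inj_on_def)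
    qed (use l in auto)
    thus "real (card {p\<in>?P. fst p * snd p = l}) \<le> real (divisor_count l)" by simp
  qed (use assms in auto)
  finally show ?thesis .
qed

lemma divisor_pair_factorisation:
  fixes d e l :: nat
  assumes "l > 0" "d dvd l" "e dvd l"
  obtains g d' e' k where "l = g * d' * e' * k" "d = g * d'" "e = g * e'"
proof -
  define g where "g = gcd d e"
  have "g > 0" using assms by (auto simp: g_def intro!: Nat.gr0I)
  obtain d' e' where d_eq: "d = g * d'" and e_eq: "e = g * e'" and "coprime d' e'"
    using gcd_coprime_exists[of d e] \<open>g > 0\<close> unfolding g_def by (auto simp: mult.commute)
  obtain m where l_eq: "l = g * m" using assms d_eq by (metis dvd_def mult.assoc)
  have "d' dvd m" "e' dvd m" using assms d_eq e_eq l_eq \<open>g > 0\<close> by auto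
  hence "d' * e' dvd m" using \<open>coprime d' e'\<close> by (simp add: divides_mult)
  then obtain k where "m = d' * e' * k" by blast
  thus ?thesis using that[of g d' e' k] l_eq d_eq e_eq by (simp add: mult_ac)
qed

lemma sum_divisor_count_sq_le: "(\<Sum>l=1..L. (real (divisor_count l))\<^sup>2 / real l) \<le> harm L ^ 4"
proof -
  let ?triples = "SIGMA l:{1..L}. {d. d dvd l} \<times> {e. e dvd l}"
  let ?quadruples = "{1..L} \<times> {1..L} \<times> {1..L} \<times> {1..L}"
  define f where "f = (\<lambda>(g :: nat, d, e, k). (g * d * e * k, g * d, g * e))"
  have "?triples \<subseteq> f ` ?quadruples"
  proof
    fix x assume "x \<in> ?triples"
    then obtain l d e where x_eq: "x = (l, d, e)" and "l > 0" "l \<le> L" "d dvd l" "e dvd l"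
      by auto
    then obtain g d' e' k where factors: "l = g * d' * e' * k" "d = g * d'" "e = g * e'"
      using divisor_pair_factorisation[of l d e] by blast
    have "n \<in> {1..L}" if "n dvd l" for n
      using that \<open>l > 0\<close> \<open>l \<le> L\<close> by (auto intro: Nat.gr0I dest: dvd_imp_le)
    hence "(g, d', e', k) \<in> ?quadruples"
      by (simp add: factors(1))
    thus "x \<in> f ` ?quadruples"
      by (rule image_eqI[rotated]) (simp add: f_def x_eq factors)
  qed
  have "(\<Sum>l=1..L. (real (divisor_count l))\<^sup>2 / real l)
      = (\<Sum>l=1..L. \<Sum>p\<in>{d. d dvd l} \<times> {e. e dvd l}. 1 / real l)"
    by (simp add: divisor_count_def card_cartesian_product power2_eq_square)
  also have "\<dots> = (\<Sum>x\<in>?triples. 1 / real (fst x))"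
    by (subst sum.Sigma) (auto simp: case_prod_beta)
  also have "\<dots> \<le> (\<Sum>x\<in>f ` ?quadruples. 1 / real (fst x))"
    using \<open>?triples \<subseteq> f ` ?quadruples\<close> by (intro sum_mono2) auto
  also have "\<dots> \<le> (\<Sum>y\<in>?quadruples. 1 / real (fst (f y)))"
    using sum_image_le[of ?quadruples "\<lambda>x. 1 / real (fst x)" f] by (simp add: o_def)
  also have "\<dots> = (\<Sum>(g, d, e, k)\<in>?quadruples.
      1 / real g * (1 / real d * (1 / real e * (1 / real k))))"
    by (intro sum.cong) (auto simp: f_def)
  also have "\<dots> = harm L * (harm L * (harm L * harm L))"
    unfolding harm_def inverse_eq_divide
    by (simp only: sum_product sum.cartesian_product) (simp add: case_prod_beta)
  finally show ?thesis by (simp add: power4_eq_xxxx)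
qed

lemma sum_products_le_mean_square:
  fixes \<phi> :: "nat \<Rightarrow> real"
  assumes "\<And>l. \<phi> l \<ge> 0"
  shows "(\<Sum>r=1..R. \<Sum>d=1..D. \<phi> (r * d)) \<le> (harm (R * D))\<^sup>2 * sqrt (\<Sum>l=1..R*D. real l * (\<phi> l)\<^sup>2)"
proof -
  let ?\<tau> = "\<lambda>l. real (divisor_count l)"
  have "(\<Sum>r=1..R. \<Sum>d=1..D. \<phi> (r * d)) \<le> (\<Sum>l=1..R*D. ?\<tau> l * \<phi> l)"
    using assms by (rule sum_products_le_sum_divisor_count)
  also have "\<dots> = (\<Sum>l=1..R*D. \<bar>?\<tau> l / sqrt (real l)\<bar> * \<bar>sqrt (real l) * \<phi> l\<bar>)"
    using assms by (intro sum.cong) (auto simp: abs_mult)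
  also have "\<dots> \<le> L2_set (\<lambda>l. ?\<tau> l / sqrt (real l)) {1..R*D}
      * L2_set (\<lambda>l. sqrt (real l) * \<phi> l) {1..R*D}"
    by (rule L2_set_mult_ineq)
  also have "\<dots> = sqrt (\<Sum>l=1..R*D. (?\<tau> l)\<^sup>2 / real l) * sqrt (\<Sum>l=1..R*D. real l * (\<phi> l)\<^sup>2)"
    by (simp add: L2_set_def power_divide power_mult_distrib)
  also have "\<dots> \<le> sqrt (((harm (R * D))\<^sup>2)\<^sup>2) * sqrt (\<Sum>l=1..R*D. real l * (\<phi> l)\<^sup>2)"
    using sum_divisor_count_sq_le[of "R * D"]
    by (intro mult_right_mono real_sqrt_le_mono) (auto intro: sum_nonneg)
  finally show ?thesis by (simp only: real_sqrt_abs abs_power2)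
qed

lemma sum_norm_sq_le_sum_geom_bound:
  fixes \<theta> :: "'a \<Rightarrow> real" and b :: "'a \<Rightarrow> complex"
  assumes b_le: "\<And>w. cmod (b w) \<le> 1"
  shows "(\<Sum>l=1..L. (cmod (\<Sum>w\<in>A. b w * e_char (real l * \<theta> w)))\<^sup>2)
     \<le> (\<Sum>w\<in>A. \<Sum>v\<in>A. geom_bound L (\<theta> w - \<theta> v))" (is "?mean_sq \<le> _")
proof -
  let ?e = "\<lambda>l w. e_char (real l * \<theta> w)"
  have e_mult_cnj: "?e l w * cnj (?e l v) = e_char (real l * (\<theta> w - \<theta> v))" for l w v
    by (simp add: right_diff_distrib flip: e_char_uminus e_char_add)
  have "complex_of_real ?mean_sq = (\<Sum>l=1..L. (\<Sum>w\<in>A. b w * ?e l w) * (\<Sum>v\<in>A. cnj (b v * ?e l v)))"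
    by (simp only: of_real_sum complex_norm_square cnj_sum)
  also have "\<dots> = (\<Sum>l=1..L. \<Sum>w\<in>A. \<Sum>v\<in>A. b w * cnj (b v) * e_char (real l * (\<theta> w - \<theta> v)))"
    by (simp add: sum_product mult_ac flip: e_mult_cnj)
  also have "\<dots> = (\<Sum>w\<in>A. \<Sum>v\<in>A. \<Sum>l=1..L. b w * cnj (b v) * e_char (real l * (\<theta> w - \<theta> v)))"
    by (subst sum.swap) (intro sum.cong refl sum.swap)
  finally have expand: "complex_of_real ?mean_sq
      = (\<Sum>w\<in>A. \<Sum>v\<in>A. b w * cnj (b v) * (\<Sum>l=1..L. e_char (real l * (\<theta> w - \<theta> v))))"
    by (simp only: sum_distrib_left)
  have "?mean_sq = cmod (complex_of_real ?mean_sq)"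
    by (simp add: sum_nonneg del: of_real_sum)
  also have "\<dots> \<le> (\<Sum>w\<in>A. \<Sum>v\<in>A. geom_bound L (\<theta> w - \<theta> v))"
    unfolding expand
  proof (intro sum_norm_le)
    fix w v
    have "cmod (b w) * cmod (b v) * cmod (\<Sum>l=1..L. e_char (real l * (\<theta> w - \<theta> v)))
        \<le> 1 * 1 * geom_bound L (\<theta> w - \<theta> v)"
      by (intro mult_mono b_le norm_interval_sum_le) auto
    thus "cmod (b w * cnj (b v) * (\<Sum>l=1..L. e_char (real l * (\<theta> w - \<theta> v))))
        \<le> geom_bound L (\<theta> w - \<theta> v)"
      by (simp add: norm_mult)
  qed
  finally show ?thesis .
qed

lemma sum_even_differences_le:
  fixes G :: "real \<Rightarrow> real"
  assumes nonneg: "\<And>x. 0 \<le> G x" and even: "\<And>x. G (- x) = G x" and w_range: "w \<in> {1..W}"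
  shows "(\<Sum>v=1..W. G (real w - real v)) \<le> G 0 + 2 * (\<Sum>h=1..W. G (real h))"
proof -
  have "{1..W} = {1..<w} \<union> insert w {w<..W}" using w_range by auto
  hence "(\<Sum>v=1..W. G (real w - real v))
      = (\<Sum>v\<in>{1..<w} \<union> insert w {w<..W}. G (real w - real v))" by simp
  also have "\<dots> = (\<Sum>v\<in>{1..<w}. G (real w - real v)) + (G 0 + (\<Sum>v\<in>{w<..W}. G (real w - real v)))"
    by (subst sum.union_disjoint) auto
  also have "(\<Sum>v\<in>{1..<w}. G (real w - real v)) = (\<Sum>h\<in>{1..<w}. G (real h))"
    by (rule sum.reindex_bij_witness[of _ "\<lambda>h. w - h" "\<lambda>v. w - v"]) (auto simp: of_nat_diff)
  also have "\<dots> \<le> (\<Sum>h=1..W. G (real h))"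
    using w_range nonneg by (intro sum_mono2) auto
  also have "(\<Sum>v\<in>{w<..W}. G (real w - real v)) = (\<Sum>h\<in>{1..W - w}. G (- real h))"
    by (rule sum.reindex_bij_witness[of _ "\<lambda>h. w + h" "\<lambda>v. v - w"]) (auto simp: of_nat_diff)
  also have "\<dots> \<le> (\<Sum>h=1..W. G (real h))"
    unfolding even using w_range nonneg by (intro sum_mono2) auto
  finally show ?thesis by simp
qed

definition trig_sum :: "(nat \<Rightarrow> complex) \<Rightarrow> nat \<Rightarrow> real \<Rightarrow> complex" where
  "trig_sum b W x = (\<Sum>w=1..W. b w * e_char (real w * x))"

lemma mean_square_trig_sum_le:
  assumes "\<And>w. cmod (b w) \<le> 1"
  shows "(\<Sum>l=1..L. (cmod (trig_sum b W (real l * x)))\<^sup>2)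
     \<le> W * (L + 2 * (\<Sum>h=1..W. geom_bound L (real h * x)))"
proof -
  have "(\<Sum>l=1..L. (cmod (trig_sum b W (real l * x)))\<^sup>2)
      = (\<Sum>l=1..L. (cmod (\<Sum>w=1..W. b w * e_char (real l * (real w * x))))\<^sup>2)"
    by (simp add: trig_sum_def mult.left_commute)
  also have "\<dots> \<le> (\<Sum>w=1..W. \<Sum>v=1..W. geom_bound L (real w * x - real v * x))"
    using assms by (rule sum_norm_sq_le_sum_geom_bound)
  also have "\<dots> \<le> (\<Sum>w=1..W. L + 2 * (\<Sum>h=1..W. geom_bound L (real h * x)))"
  proof (rule sum_mono)
    fix w assume "w \<in> {1..W}"
    hence "(\<Sum>v=1..W. geom_bound L ((real w - real v) * x))
        \<le> geom_bound L (0 * x) + 2 * (\<Sum>h=1..W. geom_bound L (real h * x))"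
      by (intro sum_even_differences_le) (auto simp: geom_bound_nonneg geom_bound_uminus)
    also have "geom_bound L (0 * x) \<le> L"
      by (rule geom_bound_le)
    finally show "(\<Sum>v=1..W. geom_bound L (real w * x - real v * x))
        \<le> L + 2 * (\<Sum>h=1..W. geom_bound L (real h * x))"
      by (simp add: left_diff_distrib)
  qed
  finally show ?thesis by simp
qed

section \<open>Separation of variables\<close>

lemma e_char_eq_1_iff: "e_char x = 1 \<longleftrightarrow> x \<in> \<int>"
proof
  assume "e_char x = 1"
  hence "nint_dist x = 0"
    using nint_dist_le_norm_e_char_diff[of x] nint_dist_nonneg[of x] by simp
  hence "x = of_int (round x)" by (simp add: nint_dist_def)
  thus "x \<in> \<int>" by (metis Ints_of_int)
qed (auto elim: Ints_cases)

lemma sum_e_char_complete: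
  fixes k :: int
  assumes "n > 0"
  shows "(\<Sum>t<n. e_char (real t * (of_int k / real n))) = of_nat n * of_bool (int n dvd k)"
proof (cases "int n dvd k")
  case True
  then obtain j where "k = int n * j" by blast
  hence "of_int k / real n = of_int j" using assms by simp
  thus ?thesis using True by (simp add: e_char_of_nat_mult)
next
  case False
  define z where "z = e_char (of_int k / real n)"
  have "z \<noteq> 1"
  proof
    assume "z = 1"
    then obtain j where "of_int k / real n = of_int j"
      unfolding z_def e_char_eq_1_iff by (auto elim: Ints_cases)
    hence "real_of_int k = of_int (j * int n)" using assms by (simp add: field_simps)
    hence "k = j * int n" by (simp only: of_int_eq_iff)
    thus False using False by simp
  qed
  moreover have "z ^ n = 1"
    using assms by (simp add: z_def flip: e_char_of_nat_mult)
  ultimately have "(\<Sum>t<n. z ^ t) = 0"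
    by (simp add: geometric_sum)
  thus ?thesis
    using False by (simp add: z_def e_char_of_nat_mult del: times_divide_eq_right)
qed

definition step_coeff :: "nat \<Rightarrow> nat \<Rightarrow> complex" where
  "step_coeff Q t = (\<Sum>s<Q. e_char (real s * - (real t / real (2 * Q)))) / of_nat (2 * Q)"

lemma step_function_fourier:
  fixes k :: int
  assumes k_less: "\<bar>k\<bar> < int Q"
  shows "(\<Sum>t<2*Q. step_coeff Q t * e_char (real t * (of_int k / real (2 * Q)))) = of_bool (0 \<le> k)"
proof -
  have "Q > 0" using k_less by linarith
  define e where "e t s = e_char (real t * (of_int (k - int s) / real (2 * Q)))" for t s
  have "step_coeff Q t * e_char (real t * (of_int k / real (2 * Q)))
      = (\<Sum>s<Q. e t s / of_nat (2 * Q))" for t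
  proof -
    have "e_char (real s * - (real t / real (2 * Q))) * e_char (real t * (of_int k / real (2 * Q)))
        = e t s" for s
      using \<open>Q > 0\<close> unfolding e_def
      by (subst e_char_add[symmetric], intro arg_cong[of _ _ e_char]) (simp add: field_simps)
    thus ?thesis
      by (simp only: step_coeff_def times_divide_eq_left sum_distrib_right sum_divide_distrib)
  qed
  hence "(\<Sum>t<2*Q. step_coeff Q t * e_char (real t * (of_int k / real (2 * Q))))
      = (\<Sum>s<Q. (\<Sum>t<2*Q. e t s) / of_nat (2 * Q))"
    by (simp only: sum_divide_distrib) (rule sum.swap)
  also have "\<dots> = (\<Sum>s<Q. of_bool (int (2 * Q) dvd k - int s))"
    using \<open>Q > 0\<close> by (simp only: e_def sum_e_char_complete[of "2 * Q"]) simp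
  also have "\<dots> = (\<Sum>s<Q. of_bool (k = int s))"
  proof (intro sum.cong refl)
    fix s assume "s \<in> {..<Q}"
    hence "\<bar>k - int s\<bar> < int (2 * Q)" using k_less by auto
    hence "int (2 * Q) dvd k - int s \<longleftrightarrow> k = int s"
      using zdvd_not_zless[of "\<bar>k - int s\<bar>" "int (2 * Q)"] by auto
    thus "(of_bool (int (2 * Q) dvd k - int s) :: complex) = of_bool (k = int s)" by simp
  qed
  also have "\<dots> = (\<Sum>s<Q. if s = nat k then of_bool (0 \<le> k) else 0)"
    by (intro sum.cong) auto
  also have "\<dots> = of_bool (0 \<le> k)"
    using k_less by (auto simp: nat_less_iff)
  finally show ?thesis .
qed

lemma of_bool_le_fourier:
  assumes "a < Q" "b < Q"
  shows "of_bool (a \<le> b) = (\<Sum>t<2*Q. step_coeff Q t *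
    (e_char (real t * (- real a / real (2 * Q))) * e_char (real t * (real b / real (2 * Q)))))"
proof -
  have "of_bool (a \<le> b)
      = (\<Sum>t<2*Q. step_coeff Q t * e_char (real t * (of_int (int b - int a) / real (2 * Q))))"
    using assms by (subst step_function_fourier) auto
  thus ?thesis
    by (simp add: diff_divide_distrib right_diff_distrib flip: e_char_add)
qed

lemma norm_step_coeff_le:
  assumes "0 < t" "t < 2 * Q"
  shows "cmod (step_coeff Q t) \<le> (1 / real t + 1 / real (2 * Q - t)) / 2"
proof -
  define y where "y = real t / real (2 * Q)"
  have "0 < y" "y < 1" using assms by (auto simp: y_def field_simps)
  hence "frac y = y" by (simp add: frac_eq)
  have "cmod (\<Sum>s<Q. e_char (real s * - y)) \<le> geom_bound Q y"
    using norm_geometric_sum_le[of 0 "- y" Q] by (simp add: geom_bound_uminus)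
  also have "\<dots> \<le> 1 / (2 * y) + 1 / (2 * (1 - y))"
    using \<open>0 < y\<close> \<open>y < 1\<close> \<open>frac y = y\<close> by (intro geom_bound_le_inverse) auto
  also have "\<dots> = (1 / real t + 1 / real (2 * Q - t)) * Q"
    using assms by (simp add: y_def field_simps of_nat_diff)
  finally have "cmod (step_coeff Q t) \<le> (1 / real t + 1 / real (2 * Q - t)) * Q / real (2 * Q)"
    unfolding step_coeff_def y_def norm_divide norm_of_nat by (intro divide_right_mono) auto
  thus ?thesis using assms by simp
qed

lemma sum_norm_step_coeff_le:
  assumes "Q \<ge> 1"
  shows "(\<Sum>t<2*Q. cmod (step_coeff Q t)) \<le> 1 + harm (2 * Q)"
proof -
  let ?H = "\<Sum>t\<in>{1..<2*Q}. 1 / real t"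
  have "{..<2*Q} = insert 0 {1..<2*Q}" using assms by auto
  hence "(\<Sum>t<2*Q. cmod (step_coeff Q t))
      = cmod (step_coeff Q 0) + (\<Sum>t\<in>{1..<2*Q}. cmod (step_coeff Q t))"
    by simp
  also have "cmod (step_coeff Q 0) \<le> 1"
    using assms by (simp add: step_coeff_def norm_divide)
  also have "(\<Sum>t\<in>{1..<2*Q}. cmod (step_coeff Q t))
      \<le> (\<Sum>t\<in>{1..<2*Q}. (1 / real t + 1 / real (2 * Q - t)) / 2)"
    by (intro sum_mono norm_step_coeff_le) auto
  also have "\<dots> = (?H + (\<Sum>t\<in>{1..<2*Q}. 1 / real (2 * Q - t))) / 2"
    by (simp add: sum.distrib flip: sum_divide_distrib)
  also have "(\<Sum>t\<in>{1..<2*Q}. 1 / real (2 * Q - t)) = ?H"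
    by (rule sum.reindex_bij_witness[of _ "\<lambda>t. 2 * Q - t" "\<lambda>t. 2 * Q - t"]) auto
  also have "(?H + ?H) / 2 = ?H" by simp
  also have "?H \<le> harm (2 * Q)"
    unfolding harm_def inverse_eq_divide by (intro sum_mono2) auto
  finally show ?thesis by simp
qed

definition bilinear_bound ::
  "'r set \<Rightarrow> 'u set \<Rightarrow> 'w set \<Rightarrow> ('r \<Rightarrow> 'u \<Rightarrow> 'w \<Rightarrow> complex) \<Rightarrow> real \<Rightarrow> bool" where
  "bilinear_bound I J M K E \<longleftrightarrow>
     (\<forall>a b. (\<forall>u. cmod (a u) \<le> 1) \<longrightarrow> (\<forall>w. cmod (b w) \<le> 1) \<longrightarrow>
       (\<Sum>r\<in>I. cmod (\<Sum>u\<in>J. \<Sum>w\<in>M. a u * b w * K r u w)) \<le> E)"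

lemma bilinear_boundI:
  assumes "\<And>a b. (\<And>u. cmod (a u) \<le> 1) \<Longrightarrow> (\<And>w. cmod (b w) \<le> 1) \<Longrightarrow>
     (\<Sum>r\<in>I. cmod (\<Sum>u\<in>J. \<Sum>w\<in>M. a u * b w * K r u w)) \<le> E"
  shows "bilinear_bound I J M K E"
  using assms unfolding bilinear_bound_def by blast

lemma bilinear_boundD:
  assumes "bilinear_bound I J M K E" "\<And>u. cmod (a u) \<le> 1" "\<And>w. cmod (b w) \<le> 1"
  shows "(\<Sum>r\<in>I. cmod (\<Sum>u\<in>J. \<Sum>w\<in>M. a u * b w * K r u w)) \<le> E"
  using assms unfolding bilinear_bound_def by blast

lemma bilinear_bound_nonneg:
  assumes "bilinear_bound I J M K E"
  shows "0 \<le> E"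
  using bilinear_boundD[OF assms, of "\<lambda>_. 0" "\<lambda>_. 0"] by simp

lemma bilinear_bound_mono: "bilinear_bound I J M K E \<Longrightarrow> E \<le> E' \<Longrightarrow> bilinear_bound I J M K E'"
  unfolding bilinear_bound_def by (meson order_trans)

lemma separation_of_variables:
  fixes K :: "'r \<Rightarrow> 'u \<Rightarrow> 'w \<Rightarrow> complex" and f :: "'u \<Rightarrow> nat" and g :: "'w \<Rightarrow> nat"
  assumes bound: "bilinear_bound I J M K E" and "Q \<ge> 1"
    and f_less: "\<And>u. u \<in> J \<Longrightarrow> f u < Q" and g_less: "\<And>w. w \<in> M \<Longrightarrow> g w < Q"
  shows "bilinear_bound I J M (\<lambda>r u w. of_bool (f u \<le> g w) * K r u w) ((1 + harm (2 * Q)) * E)"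
proof (rule bilinear_boundI)
  fix a :: "'u \<Rightarrow> complex" and b :: "'w \<Rightarrow> complex"
  assume bounded: "\<And>u. cmod (a u) \<le> 1" "\<And>w. cmod (b w) \<le> 1"
  define a' where "a' t u = a u * e_char (real t * (- real (f u) / real (2 * Q)))" for t u
  define b' where "b' t w = b w * e_char (real t * (real (g w) / real (2 * Q)))" for t w
  define S where "S t r = (\<Sum>u\<in>J. \<Sum>w\<in>M. a' t u * b' t w * K r u w)" for t r
  have expand: "a u * b w * (of_bool (f u \<le> g w) * K r u w)
      = (\<Sum>t<2*Q. step_coeff Q t * (a' t u * b' t w * K r u w))" if "u \<in> J" "w \<in> M" for r u w
    unfolding of_bool_le_fourier[OF f_less[OF that(1)] g_less[OF that(2)]]
    by (simp only: sum_distrib_left sum_distrib_right a'_def b'_def mult_ac)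
  have "(\<Sum>u\<in>J. \<Sum>w\<in>M. a u * b w * (of_bool (f u \<le> g w) * K r u w))
      = (\<Sum>t<2*Q. step_coeff Q t * S t r)" for r
  proof -
    have "(\<Sum>u\<in>J. \<Sum>w\<in>M. a u * b w * (of_bool (f u \<le> g w) * K r u w))
        = (\<Sum>u\<in>J. \<Sum>w\<in>M. \<Sum>t<2*Q. step_coeff Q t * (a' t u * b' t w * K r u w))"
      by (intro sum.cong refl expand)
    also have "\<dots> = (\<Sum>u\<in>J. \<Sum>t<2*Q. \<Sum>w\<in>M. step_coeff Q t * (a' t u * b' t w * K r u w))"
      by (intro sum.cong refl sum.swap)
    also have "\<dots> = (\<Sum>t<2*Q. \<Sum>u\<in>J. \<Sum>w\<in>M. step_coeff Q t * (a' t u * b' t w * K r u w))"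
      by (rule sum.swap)
    finally show ?thesis by (simp only: S_def sum_distrib_left)
  qed
  hence "(\<Sum>r\<in>I. cmod (\<Sum>u\<in>J. \<Sum>w\<in>M. a u * b w * (of_bool (f u \<le> g w) * K r u w)))
      \<le> (\<Sum>r\<in>I. \<Sum>t<2*Q. cmod (step_coeff Q t) * cmod (S t r))"
    by (simp only:) (intro sum_mono sum_norm_le, simp add: norm_mult)
  also have "\<dots> = (\<Sum>t<2*Q. cmod (step_coeff Q t) * (\<Sum>r\<in>I. cmod (S t r)))"
    by (subst sum.swap) (simp only: sum_distrib_left)
  also have "\<dots> \<le> (\<Sum>t<2*Q. cmod (step_coeff Q t) * E)"
    unfolding S_def
    by (intro sum_mono mult_left_mono bilinear_boundD[OF bound])
      (auto simp: a'_def b'_def norm_mult bounded)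
  also have "\<dots> \<le> (1 + harm (2 * Q)) * E"
    using sum_norm_step_coeff_le[OF \<open>Q \<ge> 1\<close>] bilinear_bound_nonneg[OF bound]
    by (simp only: sum_distrib_right[symmetric] mult_right_mono)
  finally show "(\<Sum>r\<in>I. cmod (\<Sum>u\<in>J. \<Sum>w\<in>M. a u * b w * (of_bool (f u \<le> g w) * K r u w)))
      \<le> (1 + harm (2 * Q)) * E" .
qed

section \<open>A Buchstab identity\<close>

lemma squarefree_prime_mult_iff:
  fixes s e :: nat
  assumes "prime s"
  shows "squarefree (s * e) \<longleftrightarrow> squarefree e \<and> \<not> s dvd e"
proof
  assume sqfree: "squarefree (s * e)"
  have "\<not> s dvd e"
  proof
    assume "s dvd e"
    hence "s\<^sup>2 dvd s * e" by (simp add: power2_eq_square)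
    hence "is_unit s" using sqfree by (rule squarefreeD[rotated])
    thus False using assms by simp
  qed
  with sqfree show "squarefree e \<and> \<not> s dvd e"
    by (auto dest: squarefree_multD)
next
  assume "squarefree e \<and> \<not> s dvd e"
  thus "squarefree (s * e)" using assms
    by (intro squarefree_mult_coprime prime_imp_coprime) (auto intro: squarefree_prime)
qed

lemma sum_divisors_eq_sum_pairs:
  fixes F :: "nat \<Rightarrow> nat \<Rightarrow> 'a :: comm_monoid_add"
  shows "(\<Sum>n=1..N. \<Sum>d | d dvd n. F d (n div d)) = (\<Sum>d=1..N. \<Sum>m=1..N div d. F d m)"
proof -
  have "(\<Sum>n=1..N. \<Sum>d | d dvd n. F d (n div d))
      = (\<Sum>(n, d)\<in>(SIGMA n:{1..N}. {d. d dvd n}). F d (n div d))"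
    by (rule sum.Sigma) auto
  also have "\<dots> = (\<Sum>(d, m)\<in>(SIGMA d:{1..N}. {1..N div d}). F d m)"
  proof (rule sum.reindex_bij_witness[of _ "\<lambda>(d, m). (d * m, d)" "\<lambda>(n, d). (d, n div d)"],
      goal_cases)
    case (2 x)
    then obtain d m where x_eq: "x = (d * m, d)" and "d * m \<in> {1..N}" by auto
    hence "d > 0" "m > 0" by (auto intro!: Nat.gr0I)
    moreover from this have "d \<le> N"
      using \<open>d * m \<in> {1..N}\<close> le_trans[of d "d * m" N] by simp
    moreover have "m \<le> N div d"
      using \<open>d * m \<in> {1..N}\<close> \<open>d > 0\<close> by (simp add: less_eq_div_iff_mult_less_eq mult.commute)
    ultimately show ?case by (simp add: x_eq)
  next
    case (4 y)
    thus ?case by (auto simp: less_eq_div_iff_mult_less_eq mult.commute)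
  qed auto
  also have "\<dots> = (\<Sum>d=1..N. \<Sum>m=1..N div d. F d m)"
    by (rule sum.Sigma[symmetric]) auto
  finally show ?thesis .
qed

(* The bound z stands in for the least sieving prime of an integer that has none. *)
locale prime_sieve =
  fixes P :: "nat set" and z :: nat
  assumes prime: "p \<in> P \<Longrightarrow> prime p" and le_bound: "p \<in> P \<Longrightarrow> p \<le> z"
begin

definition sieve_mu :: "nat \<Rightarrow> complex" where
  "sieve_mu d = (if squarefree d \<and> prime_factors d \<subseteq> P then (-1) ^ card (prime_factors d) else 0)"

definition least_sieve_prime :: "nat \<Rightarrow> nat" where
  "least_sieve_prime n = Min (insert z (prime_factors n \<inter> P))"

definition typeII_coeff :: "real \<Rightarrow> nat \<Rightarrow> complex" where
  "typeII_coeff X u =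
     (if X < real u \<and> real u \<le> X * real (least_sieve_prime u) then sieve_mu u else 0)"

lemma norm_sieve_mu_le: "cmod (sieve_mu d) \<le> 1"
  by (simp add: sieve_mu_def norm_power)

lemma norm_typeII_coeff_le: "cmod (typeII_coeff X u) \<le> 1"
  by (simp add: typeII_coeff_def norm_sieve_mu_le)

lemma sieve_mu_nonzeroD:
  assumes "sieve_mu d \<noteq> 0"
  shows "squarefree d" "prime_factors d \<subseteq> P" "d > 0"
proof -
  show "squarefree d" "prime_factors d \<subseteq> P"
    using assms by (auto simp: sieve_mu_def split: if_splits)
  thus "d > 0" by (auto intro: Nat.gr0I)
qed

lemma odd_if_sieve_mu_nonzero:
  assumes "sieve_mu d \<noteq> 0" "2 \<notin> P"
  shows "odd d"
proof
  assume "even d"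
  hence "2 \<in> prime_factors d"
    using sieve_mu_nonzeroD(3)[OF assms(1)] by (simp add: prime_factors_dvd)
  thus False
    using sieve_mu_nonzeroD(2)[OF assms(1)] assms(2) by blast
qed

lemma sieve_mu_prime_mult:
  assumes "s \<in> P" "\<not> s dvd e"
  shows "sieve_mu (s * e) = - sieve_mu e"
proof -
  have "e > 0" using assms(2) by (auto intro: Nat.gr0I)
  have "prime_factors (s * e) = insert s (prime_factors e)"
    using prime[OF assms(1)] \<open>e > 0\<close>
    by (subst prime_factors_product) (auto simp: prime_prime_factors)
  moreover have "s \<notin> prime_factors e" using assms(2) by (auto simp: prime_factors_dvd)
  ultimately show ?thesis
    using assms by (simp add: sieve_mu_def squarefree_prime_mult_iff prime)
qed

lemma least_sieve_prime_le_bound: "least_sieve_prime n \<le> z"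
  by (simp add: least_sieve_prime_def)

lemma least_sieve_prime_le: "p \<in> prime_factors n \<inter> P \<Longrightarrow> least_sieve_prime n \<le> p"
  by (simp add: least_sieve_prime_def)

lemma least_sieve_prime_in:
  assumes "prime_factors n \<inter> P \<noteq> {}"
  shows "least_sieve_prime n \<in> prime_factors n \<inter> P"
proof -
  have "Min (prime_factors n \<inter> P) \<in> prime_factors n \<inter> P"
    using assms by (intro Min_in) auto
  moreover from this have "least_sieve_prime n = Min (prime_factors n \<inter> P)"
    using assms le_bound by (simp add: least_sieve_prime_def min_absorb2)
  ultimately show ?thesis by simp
qed

lemma least_sieve_prime_mult:
  assumes "u > 0" "w > 0"
  shows "least_sieve_prime (u * w) = min (least_sieve_prime u) (least_sieve_prime w)"
proof -
  have "insert z (prime_factors (u * w) \<inter> P)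
      = insert z (prime_factors u \<inter> P) \<union> insert z (prime_factors w \<inter> P)"
    using assms by (auto simp: prime_factors_product)
  thus ?thesis
    unfolding least_sieve_prime_def by (simp only:) (rule Min_Un; simp)
qed

lemma least_sieve_prime_in_prime_factors:
  assumes "sieve_mu u \<noteq> 0" "u \<noteq> 1"
  shows "least_sieve_prime u \<in> prime_factors u"
proof -
  obtain p where "prime p" "p dvd u" using prime_factor_nat[OF assms(2)] by blast
  hence "p \<in> prime_factors u"
    using sieve_mu_nonzeroD(3)[OF assms(1)] by (auto simp: prime_factors_dvd)
  thus ?thesis
    using least_sieve_prime_in[of u] sieve_mu_nonzeroD(2)[OF assms(1)] by blast
qed

lemma sum_sieve_mu_paired:
  assumes s_sieving: "s \<in> P" "s dvd n" and "n > 0"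
    and h_mult: "\<And>d. \<not> s dvd d \<Longrightarrow> h (s * d) = h d"
  shows "(\<Sum>d | d dvd n. h d * sieve_mu d) = 0"
proof -
  define D where "D = {d. d dvd n \<and> \<not> s dvd d}"
  define D' where "D' = {d. d dvd n \<and> s dvd d}"
  have fin: "finite {d. d dvd n}" using \<open>n > 0\<close> by simp
  have "(\<Sum>d\<in>D'. h d * sieve_mu d) = (\<Sum>d\<in>(\<lambda>e. s * e) ` D. h d * sieve_mu d)"
  proof (rule sum.mono_neutral_right)
    show "finite D'" using fin by (rule rev_finite_subset) (auto simp: D'_def)
    show "(\<lambda>e. s * e) ` D \<subseteq> D'"
      using s_sieving prime[OF s_sieving(1)]
      by (auto simp: D_def D'_def intro!: divides_mult prime_imp_coprime)
    show "\<forall>d\<in>D' - (\<lambda>e. s * e) ` D. h d * sieve_mu d = 0"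
    proof
      fix d assume d: "d \<in> D' - (\<lambda>e. s * e) ` D"
      then obtain e where d_eq: "d = s * e" by (auto simp: D'_def)
      hence "e dvd n" using d by (auto simp: D'_def dest: dvd_mult_right)
      hence "s dvd e" using d d_eq by (auto simp: D_def)
      hence "\<not> squarefree d" using d_eq squarefree_prime_mult_iff[OF prime[OF s_sieving(1)]] by simp
      thus "h d * sieve_mu d = 0" by (simp add: sieve_mu_def)
    qed
  qed
  also have "\<dots> = (\<Sum>d\<in>D. h (s * d) * sieve_mu (s * d))"
    using prime[OF s_sieving(1)] by (subst sum.reindex) (auto simp: inj_on_def)
  also have "\<dots> = - (\<Sum>d\<in>D. h d * sieve_mu d)"
    unfolding sum_negf[symmetric]
    by (intro sum.cong refl) (simp add: D_def h_mult sieve_mu_prime_mult[OF s_sieving(1)])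
  finally have "(\<Sum>d\<in>D'. h d * sieve_mu d) = - (\<Sum>d\<in>D. h d * sieve_mu d)" .
  moreover have "{d. d dvd n} = D \<union> D'" "D \<inter> D' = {}" by (auto simp: D_def D'_def)
  ultimately show ?thesis
    using fin by (simp add: sum.union_disjoint)
qed

lemma typeII_term_eq:
  assumes "n > 0" "u dvd n" "X \<ge> 1" and sieved: "prime_factors n \<inter> P \<noteq> {}"
  defines "s \<equiv> least_sieve_prime n"
  shows "of_bool (least_sieve_prime u \<le> least_sieve_prime (n div u)) * typeII_coeff X u
    = of_bool (X < real u \<and> real u \<le> X * real s \<and> s dvd u) * sieve_mu u"
proof (cases "X < real u \<and> sieve_mu u \<noteq> 0")
  case False
  thus ?thesis by (auto simp: typeII_coeff_def)
next
  case True
  obtain w where n_eq: "n = u * w" using assms(2) by blast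
  hence pos: "u > 0" "w > 0" using assms(1) by auto
  have s_eq: "s = min (least_sieve_prime u) (least_sieve_prime w)"
    using pos by (simp add: s_def n_eq least_sieve_prime_mult)
  have "u \<noteq> 1" using True assms(3) by auto
  hence least: "least_sieve_prime u \<in> prime_factors u"
    using True by (intro least_sieve_prime_in_prime_factors) auto
  have "s \<in> P" "prime s"
    using least_sieve_prime_in[OF sieved] by (auto simp: s_def)
  hence "s dvd u \<Longrightarrow> least_sieve_prime u \<le> s"
    using pos by (intro least_sieve_prime_le) (auto simp: prime_factors_dvd)
  hence "least_sieve_prime u = s \<longleftrightarrow> s dvd u"
    using least s_eq by auto
  moreover have "least_sieve_prime u \<le> least_sieve_prime (n div u) \<longleftrightarrow> least_sieve_prime u = s"
    using pos s_eq by (auto simp: n_eq)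
  ultimately show ?thesis
    by (auto simp: typeII_coeff_def)
qed

lemma divisor_eq_1_if_sieve_mu_nonzero:
  assumes "n > 0" "prime_factors n \<inter> P = {}" "d dvd n" "sieve_mu d \<noteq> 0"
  shows "d = 1"
proof -
  have "prime_factors d = {}"
    using dvd_prime_factors[OF _ assms(3)] sieve_mu_nonzeroD(2)[OF assms(4)] assms(1,2) by auto
  thus ?thesis
    using sieve_mu_nonzeroD(3)[OF assms(4)] by (auto simp: prime_factorization_empty_iff)
qed

(* With s the least sieving prime of n, the summands of d and s d cancel for d prime to s. *)
lemma buchstab_identity:
  assumes "n > 0" "X \<ge> 1"
  shows "of_bool (prime_factors n \<inter> P = {}) =
      (\<Sum>d | d dvd n. of_bool (real d \<le> X) * sieve_mu d)
    + (\<Sum>u | u dvd n.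
        of_bool (least_sieve_prime u \<le> least_sieve_prime (n div u)) * typeII_coeff X u)"
    (is "_ = ?typeI + ?typeII")
proof (cases "prime_factors n \<inter> P = {}")
  case True
  note eq_1 = divisor_eq_1_if_sieve_mu_nonzero[OF assms(1) True]
  have "?typeI = (\<Sum>d\<in>{1}. of_bool (real d \<le> X) * sieve_mu d)"
    using assms(1) eq_1 by (intro sum.mono_neutral_right) auto
  moreover have "typeII_coeff X u = 0" if "u dvd n" for u
    using eq_1[OF that] assms(2) by (cases "sieve_mu u = 0") (auto simp: typeII_coeff_def)
  ultimately show ?thesis
    using True assms(2) by (simp add: sieve_mu_def)
next
  case False
  define s where "s = least_sieve_prime n"
  define h where "h d = (of_bool (real d \<le> (if s dvd d then X * real s else X)) :: complex)" for d
  have s_sieving: "s \<in> P" "s dvd n" "s > 0"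
    using least_sieve_prime_in[OF False] by (auto simp: s_def prime_gt_0_nat dest: prime)
  have X_le: "X * 1 \<le> X * real s"
    using s_sieving(3) assms(2) by (intro mult_left_mono) auto
  have "?typeI + ?typeII = (\<Sum>d | d dvd n. h d * sieve_mu d)"
    unfolding sum.distrib[symmetric]
  proof (intro sum.cong refl)
    fix d assume "d \<in> {d. d dvd n}"
    moreover have "real d \<le> X * real s" if "real d \<le> X"
      using X_le that by linarith
    ultimately show "of_bool (real d \<le> X) * sieve_mu d
        + of_bool (least_sieve_prime d \<le> least_sieve_prime (n div d)) * typeII_coeff X d
        = h d * sieve_mu d"
      using assms False by (auto simp: typeII_term_eq h_def s_def[symmetric])
  qed
  also have "\<dots> = 0"
  proof (rule sum_sieve_mu_paired[OF s_sieving(1,2) assms(1)])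
    fix d assume "\<not> s dvd d"
    thus "h (s * d) = h d" using s_sieving(3) by (simp add: h_def mult.commute)
  qed
  finally show ?thesis using False by simp
qed

lemma sum_sifted_eq:
  fixes F :: "nat \<Rightarrow> complex"
  assumes "X \<ge> 1"
  shows "(\<Sum>n=1..N. of_bool (prime_factors n \<inter> P = {}) * F n) =
     (\<Sum>d=1..N. of_bool (real d \<le> X) * sieve_mu d * (\<Sum>m=1..N div d. F (d * m)))
   + (\<Sum>u=1..N. typeII_coeff X u *
        (\<Sum>w=1..N div u. of_bool (least_sieve_prime u \<le> least_sieve_prime w) * F (u * w)))"
proof -
  define F1 where "F1 = (\<lambda>d m. of_bool (real d \<le> X) * sieve_mu d * F (d * m))"
  define F2 where "F2 = (\<lambda>u w. typeII_coeff X u *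
    (of_bool (least_sieve_prime u \<le> least_sieve_prime w) * F (u * w)))"
  have "of_bool (prime_factors n \<inter> P = {}) * F n
      = (\<Sum>d | d dvd n. F1 d (n div d)) + (\<Sum>d | d dvd n. F2 d (n div d))" if "n \<in> {1..N}" for n
  proof -
    have "n > 0" using that by simp
    show ?thesis
      unfolding buchstab_identity[OF \<open>n > 0\<close> assms] F1_def F2_def distrib_right sum_distrib_right
      by (intro arg_cong2[of _ _ _ _ "(+)"] sum.cong) (auto simp: mult_ac)
  qed
  hence "(\<Sum>n=1..N. of_bool (prime_factors n \<inter> P = {}) * F n)
      = (\<Sum>n=1..N. \<Sum>d | d dvd n. F1 d (n div d)) + (\<Sum>n=1..N. \<Sum>d | d dvd n. F2 d (n div d))"
    by (simp add: sum.distrib)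
  thus ?thesis
    unfolding sum_divisors_eq_sum_pairs by (simp only: F1_def F2_def sum_distrib_left)
qed

lemma typeII_coeff_support:
  assumes "typeII_coeff X u \<noteq> 0" "X \<ge> 1" and P_le: "\<And>p. p \<in> P \<Longrightarrow> real p \<le> X\<^sup>2"
  shows "X < real u" "real u \<le> X\<^sup>2" "sieve_mu u \<noteq> 0"
proof -
  define p where "p = least_sieve_prime u"
  show nonzero: "sieve_mu u \<noteq> 0" and X_less: "X < real u"
    using assms(1) by (auto simp: typeII_coeff_def split: if_splits)
  have u_le: "real u \<le> X * real p"
    using assms(1) by (auto simp: typeII_coeff_def p_def split: if_splits)
  have "u \<noteq> 1" using X_less assms(2) by auto
  hence p_factor: "p \<in> prime_factors u"
    using nonzero by (auto simp: p_def intro: least_sieve_prime_in_prime_factors)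
  then obtain e where u_eq: "u = p * e" by (auto simp: prime_factors_dvd)
  have "real p > 0"
    using p_factor by (auto simp: prime_gt_0_nat dest: in_prime_factors_imp_prime)
  hence e_le: "real e \<le> X" using u_le by (simp add: u_eq mult.commute)
  show "real u \<le> X\<^sup>2"
  proof (cases "e = 1")
    case True
    thus ?thesis using P_le[of p] p_factor sieve_mu_nonzeroD(2)[OF nonzero] by (auto simp: u_eq)
  next
    case False
    then obtain r where r: "prime r" "r dvd e" using prime_factor_nat by blast
    have "u > 0" by (rule sieve_mu_nonzeroD(3)[OF nonzero])
    hence "r \<in> prime_factors u" using r by (auto simp: u_eq prime_factors_dvd)
    hence "p \<le> r"
      using sieve_mu_nonzeroD(2)[OF nonzero] unfolding p_def by (intro least_sieve_prime_le) auto
    also have "r \<le> e" using r \<open>u > 0\<close> by (intro dvd_imp_le) (auto simp: u_eq)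
    finally have "real p * real e \<le> X * X"
      using e_le assms(2) by (intro mult_mono) auto
    thus ?thesis by (simp add: u_eq power2_eq_square)
  qed
qed

end

section \<open>Sums of two coprime squares\<close>

lemma QuadRes_minus_one_iff:
  fixes p :: nat
  assumes "prime p" "odd p"
  shows "QuadRes p (-1) \<longleftrightarrow> p mod 4 = 1"
proof -
  have p: "2 < p"
    using assms prime_ge_2_nat[of p] by (cases "p = 2") auto
  have "\<not> [-1 = 0] (mod int p)" "\<not> [1 = -1] (mod int p)" "\<not> [-1 = 1] (mod int p)"
    using p zdvd_not_zless[of 2 "int p"] by (auto simp: cong_0_iff cong_iff_dvd_diff)
  hence "QuadRes p (-1) \<longleftrightarrow> even ((p - 1) div 2)"
    using euler_criterion[OF assms(1) p, of "-1"]
    by (cases "even ((p - 1) div 2)") (auto simp: Legendre_def split: if_splits)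
  also have "\<dots> \<longleftrightarrow> p mod 4 = 1"
    using assms(2) by presburger
  finally show ?thesis .
qed

lemma prime_3_mod_4_not_dvd_sum_squares:
  fixes x y :: int and p :: nat
  assumes "coprime x y" "prime p" "p mod 4 = 3"
  shows "\<not> int p dvd x\<^sup>2 + y\<^sup>2"
proof
  assume dvd: "int p dvd x\<^sup>2 + y\<^sup>2"
  have prime: "prime (int p)" using assms by simp
  have "\<not> int p dvd y"
  proof
    assume p_dvd_y: "int p dvd y"
    hence "int p dvd x\<^sup>2" using dvd by (simp add: dvd_add_left_iff power2_eq_square)
    hence "int p dvd x" using prime by (simp add: prime_dvd_power_iff)
    with p_dvd_y show False using assms(1) prime by (meson coprime_common_divisor not_prime_unit)
  qed
  hence "coprime y (int p)" using prime prime_imp_coprime coprime_commute by blast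
  then obtain z where yz_cong: "[y * z = 1] (mod int p)" using cong_solve_coprime_int by blast
  have "[(x * z)\<^sup>2 = (x\<^sup>2 + y\<^sup>2) * z\<^sup>2 - (y * z)\<^sup>2] (mod int p)"
    by (simp add: algebra_simps)
  also have "[(x\<^sup>2 + y\<^sup>2) * z\<^sup>2 - (y * z)\<^sup>2 = 0 * z\<^sup>2 - 1\<^sup>2] (mod int p)"
    using dvd yz_cong by (intro cong_diff cong_mult cong_pow cong_refl) (auto simp: cong_0_iff)
  finally have "QuadRes p (-1)" by (auto simp: QuadRes_def)
  moreover have "odd p" using assms by presburger
  ultimately show False using QuadRes_minus_one_iff[of p] assms by simp
qed

lemma cong_1_imp_power_cong_1_square:
  fixes z :: int
  assumes "[z = 1] (mod int m)"
  shows "[z ^ m = 1] (mod (int m)\<^sup>2)"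
proof -
  have "[(\<Sum>i<m. z ^ i) = (\<Sum>i<m. 1 ^ i)] (mod int m)"
    using assms by (intro cong_sum cong_pow)
  hence "int m dvd (\<Sum>i<m. z ^ i)"
    by (simp add: cong_dvd_iff)
  moreover have "int m dvd z - 1"
    using assms by (simp add: cong_iff_dvd_diff)
  ultimately have "(int m)\<^sup>2 dvd (z - 1) * (\<Sum>i<m. z ^ i)"
    unfolding power2_eq_square by (intro mult_dvd_mono)
  thus ?thesis
    by (simp add: cong_iff_dvd_diff power_diff_1_eq)
qed

lemma square_dvd_power_square_plus_1:
  fixes x :: int
  assumes "odd m" "int m dvd x\<^sup>2 + 1"
  shows "(int m)\<^sup>2 dvd (x ^ m)\<^sup>2 + 1"
proof -
  have "int m dvd - (x\<^sup>2 + 1)"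
    using assms(2) by (simp only: dvd_minus_iff)
  hence "[- x\<^sup>2 = 1] (mod int m)"
    by (simp add: cong_iff_dvd_diff)
  hence "[(- x\<^sup>2) ^ m = 1] (mod (int m)\<^sup>2)"
    by (rule cong_1_imp_power_cong_1_square)
  moreover have "(- x\<^sup>2) ^ m = - (x ^ m)\<^sup>2"
    using assms(1) by (simp add: power_minus_odd mult.commute flip: power_mult)
  ultimately have "(int m)\<^sup>2 dvd - ((x ^ m)\<^sup>2 + 1)"
    by (simp add: cong_iff_dvd_diff)
  thus ?thesis by (simp only: dvd_minus_iff)
qed

lemma dvd_square_plus_1_mult:
  fixes x y :: int
  assumes "coprime (int m) (int n)" "int m dvd x\<^sup>2 + 1" "int n dvd y\<^sup>2 + 1"
  obtains w :: int where "int (m * n) dvd w\<^sup>2 + 1"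
proof -
  obtain w where w: "[w = x] (mod int m)" "[w = y] (mod int n)"
    using binary_chinese_remainder_int[OF assms(1)] by blast
  have "[w\<^sup>2 + 1 = x\<^sup>2 + 1] (mod int m)" "[w\<^sup>2 + 1 = y\<^sup>2 + 1] (mod int n)"
    by (intro cong_add cong_pow w cong_refl)+
  hence "int m dvd w\<^sup>2 + 1" "int n dvd w\<^sup>2 + 1"
    using assms(2,3) by (simp_all add: cong_dvd_iff)
  hence "int (m * n) dvd w\<^sup>2 + 1"
    using divides_mult[OF _ _ assms(1)] by simp
  thus ?thesis by (rule that)
qed

lemma exists_sqrt_minus_one:
  fixes n :: nat
  assumes "n > 0" "odd n" "\<And>p. prime p \<Longrightarrow> p dvd n \<Longrightarrow> p mod 4 \<noteq> 3"
  shows "\<exists>x::int. int n dvd x\<^sup>2 + 1"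
  using assms
proof (induction n rule: less_induct)
  case (less n)
  show ?case
  proof (cases "n = 1")
    case False
    then obtain p m where p: "prime p" and n_eq: "n = p * m"
      using prime_factor_nat by blast
    have odd: "odd p" "odd m" using less.prems(2) n_eq by auto
    have "m < n" "m > 0" using n_eq less.prems(1) prime_gt_1_nat[OF p] by auto
    then obtain x where x: "int m dvd x\<^sup>2 + 1"
      using less.IH[of m] less.prems(3) odd n_eq by auto
    show ?thesis
    proof (cases "p dvd m")
      case True
      hence "int n dvd (int m)\<^sup>2"
        by (simp add: n_eq power2_eq_square mult_dvd_mono)
      thus ?thesis
        using square_dvd_power_square_plus_1[OF odd(2) x] by (blast intro: dvd_trans)
    next
      case False
      have "p mod 4 = 1" using less.prems(3)[OF p] odd n_eq by (simp; presburger)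
      then obtain y where "[y\<^sup>2 = -1] (mod int p)"
        using QuadRes_minus_one_iff[OF p odd(1)] by (auto simp: QuadRes_def)
      hence "int p dvd y\<^sup>2 + 1" by (simp add: cong_iff_dvd_diff)
      moreover have "coprime (int p) (int m)" using False p by (simp add: prime_imp_coprime)
      ultimately show ?thesis
        using x unfolding n_eq by (blast elim: dvd_square_plus_1_mult)
    qed
  qed simp
qed

lemma thue:
  fixes n :: nat and x :: int
  assumes "n > 0"
  obtains u v :: int where "u \<noteq> 0 \<or> v \<noteq> 0" "u\<^sup>2 \<le> int n" "v\<^sup>2 \<le> int n" "int n dvd u - x * v"
proof -
  define k where "k = floor_sqrt n"
  define residue where "residue = (\<lambda>(u, v). (u - x * v) mod int n)"
  let ?box = "{0..int k} \<times> {0..int k}"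
  have "\<not> inj_on residue ?box"
  proof
    assume "inj_on residue ?box"
    moreover have "residue ` ?box \<subseteq> {0..<int n}" using assms by (auto simp: residue_def)
    ultimately have "card ?box \<le> card {0..<int n}" by (intro card_inj_on_le[of residue]) auto
    moreover have "nat (int k + 1) = Suc k" by simp
    ultimately have "(Suc k)\<^sup>2 \<le> n" by (simp add: card_cartesian_product power2_eq_square)
    thus False using Suc_floor_sqrt_power2_gt[of n] by (simp add: k_def)
  qed
  then obtain u1 v1 u2 v2 where uv: "(u1, v1) \<in> ?box" "(u2, v2) \<in> ?box" "(u1, v1) \<noteq> (u2, v2)"
    "residue (u1, v1) = residue (u2, v2)"
    by (auto simp: inj_on_def)
  have "int n dvd (u1 - x * v1) - (u2 - x * v2)"
    using uv(4) by (simp add: residue_def mod_eq_dvd_iff)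
  hence "int n dvd (u1 - u2) - x * (v1 - v2)"
    by (simp add: algebra_simps)
  moreover have "(int k)\<^sup>2 \<le> int n"
    unfolding k_def by (metis floor_sqrt_power2_le of_nat_le_iff of_nat_power)
  hence "d\<^sup>2 \<le> int n" if "\<bar>d\<bar> \<le> \<bar>int k\<bar>" for d
    using that unfolding abs_le_square_iff by linarith
  hence "(u1 - u2)\<^sup>2 \<le> int n" "(v1 - v2)\<^sup>2 \<le> int n"
    using uv(1,2) by auto
  ultimately show ?thesis
    using that[of "u1 - u2" "v1 - v2"] uv(3) by auto
qed

lemma dvd_sum_squares_if_dvd_diff:
  fixes n u v x :: int
  assumes "n dvd x\<^sup>2 + 1" "n dvd u - x * v"
  shows "n dvd u\<^sup>2 + v\<^sup>2"
proof -
  have "u\<^sup>2 + v\<^sup>2 = (u - x * v) * (u + x * v) + v\<^sup>2 * (x\<^sup>2 + 1)"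
    by (simp add: power2_eq_square algebra_simps)
  thus ?thesis using assms by simp
qed

lemma common_divisor_dvd_cofactor:
  fixes n u v x s d :: int
  assumes "n \<noteq> 0" "n dvd x\<^sup>2 + 1" "n dvd u - x * v" and cofactor: "u\<^sup>2 + v\<^sup>2 = n * s"
    and "d dvd u" "d dvd v"
  shows "d dvd s"
proof -
  obtain c where x_eq: "x\<^sup>2 + 1 = n * c" using assms(2) by blast
  obtain j where "u - x * v = n * j" using assms(3) by blast
  hence u_eq: "u = x * v + n * j" by simp
  have "n * s = v\<^sup>2 * (x\<^sup>2 + 1) + n * (2 * x * v * j + n * j\<^sup>2)"
    unfolding cofactor[symmetric] u_eq by (simp add: power2_eq_square algebra_simps)
  also have "\<dots> = n * (v * (v * c + x * j) + u * j)"
    unfolding x_eq u_eq by (simp add: power2_eq_square algebra_simps)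
  finally have "s = v * (v * c + x * j) + u * j" using assms(1) by simp
  thus ?thesis using assms(5,6) by simp
qed

(* Thue's lemma gives u\<^sup>2 + v\<^sup>2 = n s with s \<le> 2, and every common divisor of u and v divides s. *)
lemma coprime_sum_squares_if_dvd_square_plus_1:
  fixes n :: nat and x :: int
  assumes "odd n" "int n dvd x\<^sup>2 + 1"
  shows "\<exists>u v :: int. coprime u v \<and> int n = u\<^sup>2 + v\<^sup>2"
proof (cases "n = 1")
  case True
  thus ?thesis by (intro exI[of _ 1] exI[of _ 0]) auto
next
  case False
  have "n > 0" using assms(1) by (auto intro: Nat.gr0I)
  then obtain u v where uv: "u \<noteq> 0 \<or> v \<noteq> 0" "u\<^sup>2 \<le> int n" "v\<^sup>2 \<le> int n" "int n dvd u - x * v"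
    using thue by blast
  obtain s where cofactor: "u\<^sup>2 + v\<^sup>2 = int n * s"
    using dvd_sum_squares_if_dvd_diff[OF assms(2) uv(4)] by blast
  have common_divisor: "d dvd s" if "d dvd u" "d dvd v" for d
    using common_divisor_dvd_cofactor[OF _ assms(2) uv(4) cofactor that] \<open>n > 0\<close> by simp
  have "0 < int n * s"
    unfolding cofactor[symmetric] using uv(1) by (simp add: sum_power2_gt_zero_iff)
  hence "0 < s" using \<open>n > 0\<close> by (simp add: zero_less_mult_iff)
  moreover have "int n * s \<le> int n * 2"
    using uv(2,3) cofactor by linarith
  hence "s \<le> 2" using \<open>n > 0\<close> by simp
  moreover have "s \<noteq> 2"
  proof
    assume "s = 2"
    hence "u\<^sup>2 + v\<^sup>2 = 2 * int n" using cofactor by simp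
    hence n_eq: "int n = u\<^sup>2" "u\<^sup>2 = v\<^sup>2" using uv(2,3) by linarith+
    hence "u dvd v" by (auto simp: power2_eq_iff)
    hence "u dvd 2" using common_divisor[of u] \<open>s = 2\<close> by simp
    hence "\<bar>u\<bar> \<le> 2" using dvd_imp_le_int[of 2 u] by simp
    hence "u \<in> {-2, -1, 0, 1, 2}" by auto
    thus False using n_eq(1) assms(1) False by auto
  qed
  ultimately have "s = 1" by linarith
  thus ?thesis
    using common_divisor cofactor by (intro exI[of _ u] exI[of _ v]) (auto intro: coprimeI)
qed

lemma BB_iff: "n \<in> BB \<longleftrightarrow> n > 0 \<and> odd n \<and> (\<forall>p. prime p \<longrightarrow> p dvd n \<longrightarrow> p mod 4 \<noteq> 3)"
proof
  assume "n \<in> BB"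
  then obtain x y :: int where n: "n > 0" "odd n" "coprime x y" "int n = x\<^sup>2 + y\<^sup>2"
    by (auto simp: BB_def)
  moreover have "p mod 4 \<noteq> 3" if "prime p" "p dvd n" for p
    using prime_3_mod_4_not_dvd_sum_squares[OF n(3) that(1)] that(2) n(4) by (metis int_dvd_int_iff)
  ultimately show "n > 0 \<and> odd n \<and> (\<forall>p. prime p \<longrightarrow> p dvd n \<longrightarrow> p mod 4 \<noteq> 3)" by blast
next
  assume n: "n > 0 \<and> odd n \<and> (\<forall>p. prime p \<longrightarrow> p dvd n \<longrightarrow> p mod 4 \<noteq> 3)"
  then obtain x :: int where "int n dvd x\<^sup>2 + 1" using exists_sqrt_minus_one[of n] by blast
  thus "n \<in> BB" using coprime_sum_squares_if_dvd_square_plus_1[of n x] n by (simp add: BB_def)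
qed

lemma prime_factor_3_mod_4:
  fixes m :: nat
  assumes "m mod 4 = 3"
  shows "\<exists>p. prime p \<and> p mod 4 = 3 \<and> p dvd m"
  using assms
proof (induction m rule: less_induct)
  case (less m)
  have "m \<noteq> 1" using less.prems by auto
  then obtain p k where p: "prime p" and m_eq: "m = p * k" using prime_factor_nat by blast
  show ?case
  proof (cases "p mod 4 = 3")
    case False
    have "odd m" using less.prems by presburger
    hence "p mod 4 = 1" using m_eq False by (simp; presburger)
    moreover have "(p mod 4) * (k mod 4) mod 4 = 3"
      using less.prems by (simp only: m_eq mod_mult_eq)
    ultimately have k_mod: "k mod 4 = 3" by simp
    hence "k < m" using m_eq prime_gt_1_nat[OF p] by (cases "k = 0") auto
    from less.IH[OF this k_mod] show ?thesis using m_eq by (metis dvd_mult)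
  qed (use p m_eq in auto)
qed

lemma small_prime_factor_3_mod_4:
  fixes n :: nat
  assumes "n mod 4 = 1" and p: "prime p" "p mod 4 = 3" "p dvd n"
  obtains r where "prime r" "r mod 4 = 3" "r dvd n" "r\<^sup>2 \<le> n"
proof -
  obtain m where n_eq: "n = p * m" using p by blast
  have "(p mod 4) * (m mod 4) mod 4 = 1"
    using assms(1) by (simp only: n_eq mod_mult_eq)
  moreover have "m mod 4 \<in> {0, 1, 2, 3}" by auto
  ultimately have "m mod 4 = 3" using p(2) by auto
  then obtain r where r: "prime r" "r mod 4 = 3" "r dvd m"
    using prime_factor_3_mod_4 by blast
  have "n > 0" using assms(1) by presburger
  hence "p * r \<le> n" using r n_eq by (intro dvd_imp_le) auto
  moreover have "p\<^sup>2 \<le> p * r \<or> r\<^sup>2 \<le> p * r"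
    using linear[of p r] by (auto simp: power2_eq_square)
  ultimately have "p\<^sup>2 \<le> n \<or> r\<^sup>2 \<le> n" by linarith
  thus ?thesis using that p r n_eq by auto
qed

definition sieve_primes :: "nat \<Rightarrow> nat set" where
  "sieve_primes N = {p. prime p \<and> p mod 4 = 3 \<and> p\<^sup>2 \<le> N}"

lemma prime_sieve_sieve_primes: "prime_sieve (sieve_primes N) N"
proof
  fix p assume p: "p \<in> sieve_primes N"
  thus "prime p" by (simp add: sieve_primes_def)
  have "p \<le> p\<^sup>2" by (simp add: power2_eq_square)
  with p show "p \<le> N" by (simp add: sieve_primes_def)
qed

lemma BB_iff_sifted:
  assumes "n \<le> N"
  shows "n \<in> BB \<longleftrightarrow> n mod 4 = 1 \<and> prime_factors n \<inter> sieve_primes N = {}"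
proof
  assume n: "n \<in> BB"
  have "n mod 4 \<noteq> 3"
    using n prime_factor_3_mod_4[of n] unfolding BB_iff by blast
  moreover have "odd n" using n by (simp add: BB_iff)
  ultimately have "n mod 4 = 1" by presburger
  thus "n mod 4 = 1 \<and> prime_factors n \<inter> sieve_primes N = {}"
    using n by (auto simp: BB_iff sieve_primes_def prime_factors_dvd)
next
  assume n: "n mod 4 = 1 \<and> prime_factors n \<inter> sieve_primes N = {}"
  hence "n mod 4 = 1" by simp
  hence pos: "n > 0" "odd n" by presburger+
  have "p mod 4 \<noteq> 3" if p: "prime p" "p dvd n" for p
  proof
    assume "p mod 4 = 3"
    then obtain r where "prime r" "r mod 4 = 3" "r dvd n" "r\<^sup>2 \<le> n"
      using small_prime_factor_3_mod_4[of n p] n p by blast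
    thus False
      using n pos(1) assms by (auto simp: sieve_primes_def prime_factors_dvd)
  qed
  thus "n \<in> BB" using pos by (simp add: BB_iff)
qed

section \<open>Type I and type II sums\<close>

lemma mult_mod_4_eq_1_iff:
  fixes u w :: nat
  assumes "odd u"
  shows "(u * w) mod 4 = 1 \<longleftrightarrow> w mod 4 = u mod 4"
proof -
  have "u mod 4 \<in> {1, 3}" using assms by (simp; presburger)
  moreover have "w mod 4 \<in> {0, 1, 2, 3}" by auto
  moreover have "(u * w) mod 4 = (u mod 4) * (w mod 4) mod 4" by (simp only: mod_mult_eq)
  ultimately show ?thesis by auto
qed

lemma norm_typeI_inner_sum_le:
  assumes "odd d"
  shows "cmod (\<Sum>m=1..N div d. of_bool ((d * m) mod 4 = 1) * e_char (real (d * m) * x))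
    \<le> geom_bound (real N / real d) (4 * (real d * x))"
proof -
  have "0 < d mod 4" using assms by presburger
  have "cmod (\<Sum>m=1..N div d. of_bool ((d * m) mod 4 = 1) * e_char (real (d * m) * x))
      = cmod (\<Sum>m=1..N div d. of_bool (m mod 4 = d mod 4) * e_char (real m * (real d * x)))"
    unfolding mult_mod_4_eq_1_iff[OF assms] by (simp add: mult_ac)
  also have "\<dots> \<le> geom_bound (real (N div d)) (real 4 * (real d * x))"
    using \<open>0 < d mod 4\<close> by (intro norm_progression_sum_le) auto
  also have "\<dots> \<le> geom_bound (real N / real d) (4 * (real d * x))"
    using geom_bound_mono[OF of_nat_div_le_of_nat] by simp
  finally show ?thesis .
qed

lemma sum_hyperbola_fibre:
  fixes F :: "nat \<Rightarrow> 'a :: semiring_1"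
  assumes "0 < v" "v \<le> u"
  shows "(\<Sum>w=1..N div u. F w) = (\<Sum>w=1..N div v. of_bool (u \<le> N div w) * F w)"
proof (rule sum.mono_neutral_cong_left)
  have "N div u \<le> N div v" using assms by (intro div_le_mono2)
  thus "{1..N div u} \<subseteq> {1..N div v}" by auto
qed (use assms in \<open>auto simp: less_eq_div_iff_mult_less_eq mult.commute\<close>)

lemma sum_dyadic:
  fixes G :: "nat \<Rightarrow> 'a :: comm_monoid_add"
  shows "(\<Sum>u\<in>{1..<2^n}. G u) = (\<Sum>i<n. \<Sum>u\<in>{2^i..<2*2^i}. G u)"
proof (induction n)
  case (Suc n)
  have "(\<Sum>u\<in>{1..<2^Suc n}. G u) = (\<Sum>u\<in>{1..<2^n}. G u) + (\<Sum>u\<in>{2^n..<2^Suc n}. G u)"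
    by (rule sum.atLeastLessThan_concat[symmetric]) auto
  thus ?case using Suc by simp
qed auto

lemma sum_hyperbola_dyadic:
  fixes F :: "nat \<Rightarrow> nat \<Rightarrow> 'a :: semiring_1"
  assumes "N < 2 ^ n"
  shows "(\<Sum>u=1..N. \<Sum>w=1..N div u. F u w)
    = (\<Sum>i<n. \<Sum>u\<in>{2^i..<2*2^i}. \<Sum>w=1..N div 2^i. of_bool (u \<le> N div w) * F u w)"
proof -
  have "(\<Sum>u=1..N. \<Sum>w=1..N div u. F u w) = (\<Sum>u\<in>{1..<2^n}. \<Sum>w=1..N div u. F u w)"
    using assms by (intro sum.mono_neutral_left) auto
  also have "\<dots> = (\<Sum>i<n. \<Sum>u\<in>{2^i..<2*2^i}. \<Sum>w=1..N div u. F u w)"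
    by (rule sum_dyadic)
  also have "\<dots> = (\<Sum>i<n. \<Sum>u\<in>{2^i..<2*2^i}. \<Sum>w=1..N div 2^i. of_bool (u \<le> N div w) * F u w)"
    by (intro sum.cong refl sum_hyperbola_fibre) auto
  finally show ?thesis .
qed

lemma half_le_harm_power_two: "real k / 2 \<le> harm (2 ^ k)"
proof -
  have "real k * (1 / 2) \<le> real k * ln 2"
    using ln2_ge_two_thirds by (intro mult_left_mono) auto
  also have "\<dots> = ln (2 ^ k)"
    by (simp add: ln_realpow)
  also have "\<dots> \<le> ln (real (2 ^ k) + 1)"
    by (intro ln_mono) auto
  also have "\<dots> \<le> harm (2 ^ k)"
    by (rule ln_le_harm)
  finally show ?thesis by simp
qed

lemma sqrt_le_mult_sqrt:
  assumes "x \<le> c\<^sup>2 * y" "0 \<le> c"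
  shows "sqrt x \<le> c * sqrt y"
  using real_sqrt_le_mono[OF assms(1)] assms(2) by (simp add: real_sqrt_mult)

lemma Suc_le_harm:
  assumes "2 ^ k \<le> N" "8 * N\<^sup>2 \<le> M"
  shows "real (Suc k) \<le> harm M"
proof -
  have "(2 ^ k)\<^sup>2 \<le> N\<^sup>2" using assms(1) by (intro power_mono) auto
  hence "2 ^ (2 * Suc k) \<le> M"
    using assms(2) by (simp add: power_mult[symmetric] mult.commute)
  hence "harm (2 ^ (2 * Suc k)) \<le> (harm M :: real)" by (rule harm_mono)
  thus ?thesis
    using half_le_harm_power_two[of "2 * Suc k"] by simp
qed

context rational_approx
begin

definition phase :: "nat \<Rightarrow> nat \<Rightarrow> complex" where
  "phase r n = e_char (real n * (real r * \<alpha>))"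

definition error_term :: "nat \<Rightarrow> nat \<Rightarrow> real \<Rightarrow> real" where
  "error_term R N x = sqrt (real R * N * (real R * N / q + x + q))"

lemma error_term_mono: "x \<le> y \<Longrightarrow> error_term R N x \<le> error_term R N y"
  unfolding error_term_def by (intro real_sqrt_le_mono mult_left_mono) auto

lemma error_term_nonneg: "0 \<le> x \<Longrightarrow> 0 \<le> error_term R N x"
  by (simp add: error_term_def)

lemma one_le_harm_if_q_le: "2 * q \<le> M \<Longrightarrow> 1 \<le> (harm M :: real)"
  using q_ge_1 by (intro one_le_harm) auto

lemma vinogradov_sum_dilated_le:
  assumes "Z \<ge> 0" "2 * q \<le> M" "k \<ge> 1" "k * L \<le> M"
  shows "(\<Sum>l=1..L. geom_bound (Z / real l) (real k * (real l * \<alpha>)))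
    \<le> 4 * real k * harm M * (Z / q + L + q)"
proof -
  have "(\<Sum>l=1..L. geom_bound (Z / real l) (real k * (real l * \<alpha>)))
      = (\<Sum>l\<in>(\<lambda>l. k * l) ` {1..L}. geom_bound (real k * Z / real l) (real l * \<alpha>))"
    using assms(3) by (subst sum.reindex) (auto simp: inj_on_def mult_ac)
  also have "\<dots> \<le> (\<Sum>l=1..k*L. geom_bound (real k * Z / real l) (real l * \<alpha>))"
    using assms(1,3) by (intro sum_mono2) (auto intro: geom_bound_nonneg)
  also have "\<dots> \<le> 4 * harm M * (real k * Z / q + real (k * L) + q)"
    using assms by (intro vinogradov_sum_le) auto
  also have "\<dots> \<le> 4 * harm M * (real k * (Z / q + L + q))"
    using mult_right_mono[of 1 "real k" "real q"] assms(3)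
    by (intro mult_left_mono) (auto simp: distrib_left harm_nonneg)
  finally show ?thesis by (simp add: mult_ac)
qed

lemma weighted_sum_geom_bound_sq_le:
  assumes "Z \<ge> 0" "2 * q \<le> M" "k \<ge> 1" "k * L \<le> M"
  shows "(\<Sum>l=1..L. real l * (geom_bound (Z / real l) (real k * (real l * \<alpha>)))\<^sup>2)
    \<le> (2 * sqrt k * harm M)\<^sup>2 * (Z * (Z / q + L + q))"
proof -
  define \<phi> where "\<phi> l = geom_bound (Z / real l) (real k * (real l * \<alpha>))" for l
  have "(\<Sum>l=1..L. real l * (\<phi> l)\<^sup>2) \<le> (\<Sum>l=1..L. Z * \<phi> l)"
  proof (rule sum_mono)
    fix l assume "l \<in> {1..L}"
    hence "real l * \<phi> l \<le> Z"
      using geom_bound_le[of "Z / real l"] by (simp add: \<phi>_def field_simps)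
    moreover have "0 \<le> \<phi> l" using assms(1) by (simp add: \<phi>_def geom_bound_nonneg)
    ultimately have "real l * \<phi> l * \<phi> l \<le> Z * \<phi> l" by (rule mult_right_mono)
    thus "real l * (\<phi> l)\<^sup>2 \<le> Z * \<phi> l" by (simp add: power2_eq_square mult.assoc)
  qed
  also have "\<dots> = Z * (\<Sum>l=1..L. \<phi> l)"
    by (simp only: sum_distrib_left)
  also have "\<dots> \<le> Z * (4 * real k * harm M * (Z / q + L + q))"
    unfolding \<phi>_def using assms by (intro mult_left_mono vinogradov_sum_dilated_le)
  also have "\<dots> = 4 * real k * harm M * 1 * (Z * (Z / q + L + q))"
    by (simp only: mult_ac mult_1)
  also have "\<dots> \<le> 4 * real k * harm M * harm M * (Z * (Z / q + L + q))"
    using one_le_harm_if_q_le[OF assms(2)] assms(1) by (intro mult_right_mono mult_left_mono) auto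
  also have "\<dots> = (2 * sqrt k * harm M)\<^sup>2 * (Z * (Z / q + L + q))"
    by (simp add: power_mult_distrib power2_eq_square[of "harm M"])
  finally show ?thesis by (simp only: \<phi>_def)
qed

lemma sum_sum_geom_bound_le:
  assumes "2 * q \<le> M" "k \<ge> 1" "k * (R * Y) \<le> M"
  shows "(\<Sum>r=1..R. \<Sum>d=1..Y. geom_bound (real N / real d) (real k * (real (r * d) * \<alpha>)))
     \<le> 2 * sqrt k * harm M ^ 3 * error_term R N (real R * Y)"
proof -
  define \<phi> where "\<phi> l = geom_bound (real R * N / real l) (real k * (real l * \<alpha>))" for l
  have "(\<Sum>r=1..R. \<Sum>d=1..Y. geom_bound (real N / real d) (real k * (real (r * d) * \<alpha>)))
      \<le> (\<Sum>r=1..R. \<Sum>d=1..Y. \<phi> (r * d))"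
    unfolding \<phi>_def
  proof (intro sum_mono geom_bound_mono)
    fix r d assume r: "r \<in> {1..R}" and "d \<in> {1..Y}"
    have "real N / real d = real r * real N / real (r * d)" using r by simp
    also have "\<dots> \<le> real R * real N / real (r * d)"
      using r by (intro divide_right_mono mult_right_mono) auto
    finally show "real N / real d \<le> real R * real N / real (r * d)" .
  qed
  also have "\<dots> \<le> (harm (R * Y))\<^sup>2 * sqrt (\<Sum>l=1..R*Y. real l * (\<phi> l)\<^sup>2)"
    by (rule sum_products_le_mean_square) (simp add: \<phi>_def geom_bound_nonneg)
  also have "\<dots> \<le> (harm M)\<^sup>2 * (2 * sqrt k * harm M * error_term R N (real R * Y))"
  proof (intro mult_mono power_mono harm_mono)
    show "sqrt (\<Sum>l=1..R*Y. real l * (\<phi> l)\<^sup>2) \<le> 2 * sqrt k * harm M * error_term R N (real R * Y)"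
      using weighted_sum_geom_bound_sq_le[OF _ assms, of "real R * N"]
      unfolding error_term_def \<phi>_def by (intro sqrt_le_mult_sqrt) (auto simp: harm_nonneg)
    have "R * Y \<le> k * (R * Y)" using assms(2) by simp
    thus "R * Y \<le> M" using assms(3) by (rule le_trans)
  qed (auto simp: harm_nonneg intro: sum_nonneg)
  finally show ?thesis by (simp add: power2_eq_square power3_eq_cube mult_ac)
qed

lemma typeI_sum_le:
  assumes c_bounds: "\<And>d. cmod (c d) \<le> 1" "\<And>d. c d \<noteq> 0 \<Longrightarrow> odd d \<and> d \<le> Y"
    and M_ge: "2 * q \<le> M" "4 * (R * Y) \<le> M"
  shows "(\<Sum>r=1..R. cmod (\<Sum>d=1..N. c d *
        (\<Sum>m=1..N div d. of_bool ((d * m) mod 4 = 1) * phase r (d * m))))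
     \<le> 4 * harm M ^ 3 * error_term R N (real R * Y)"
proof -
  define G where "G r d = geom_bound (real N / real d) (real 4 * (real (r * d) * \<alpha>))" for r d
  have "(\<Sum>r=1..R. cmod (\<Sum>d=1..N. c d *
        (\<Sum>m=1..N div d. of_bool ((d * m) mod 4 = 1) * phase r (d * m))))
      \<le> (\<Sum>r=1..R. \<Sum>d=1..N. of_bool (d \<le> Y) * G r d)"
  proof (intro sum_mono sum_norm_le)
    fix r d :: nat
    define S where "S = (\<Sum>m=1..N div d. of_bool ((d * m) mod 4 = 1) * phase r (d * m))"
    have "cmod (c d) * cmod S \<le> 1 * geom_bound (real N / real d) (4 * (real d * (real r * \<alpha>)))"
      if "odd d"
      unfolding S_def phase_def by (intro mult_mono c_bounds norm_typeI_inner_sum_le that) auto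
    thus "cmod (c d * S) \<le> of_bool (d \<le> Y) * G r d"
      using c_bounds(2)[of d]
      by (cases "c d = 0") (auto simp: G_def norm_mult geom_bound_nonneg mult_ac)
  qed
  also have "\<dots> \<le> (\<Sum>r=1..R. \<Sum>d=1..Y. G r d)"
  proof (rule sum_mono)
    fix r
    have "(\<Sum>d=1..N. of_bool (d \<le> Y) * G r d) = (\<Sum>d=1..min N Y. G r d)"
      by (intro sum.mono_neutral_cong_right) auto
    also have "\<dots> \<le> (\<Sum>d=1..Y. G r d)"
      by (intro sum_mono2) (auto simp: G_def geom_bound_nonneg)
    finally show "(\<Sum>d=1..N. of_bool (d \<le> Y) * G r d) \<le> (\<Sum>d=1..Y. G r d)" .
  qed
  also have "\<dots> \<le> 2 * sqrt (real 4) * harm M ^ 3 * error_term R N (real R * Y)"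
    unfolding G_def using M_ge by (intro sum_sum_geom_bound_le) auto
  finally show ?thesis by simp
qed

lemma mean_square_trig_sum_multiples_le:
  assumes "\<And>w. cmod (b w) \<le> 1" "2 * q \<le> M" "W \<le> M"
  shows "(\<Sum>l=1..L. (cmod (trig_sum b W (real l * \<alpha>)))\<^sup>2)
     \<le> real W * (L + 8 * harm M * (real L * W / q + W + q))"
proof -
  have "(\<Sum>h=1..W. geom_bound L (real h * \<alpha>))
      \<le> (\<Sum>h=1..W. geom_bound (real L * W / real h) (real h * \<alpha>))"
  proof (intro sum_mono geom_bound_mono)
    fix h assume h: "h \<in> {1..W}"
    hence "real L * real h \<le> real L * W" by (intro mult_left_mono) auto
    thus "real L \<le> real L * W / real h" using h by (simp add: field_simps)
  qed
  also have "\<dots> \<le> 4 * harm M * (real L * W / q + W + q)"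
    using assms(2,3) by (intro vinogradov_sum_le) auto
  finally have "real W * (L + 2 * (\<Sum>h=1..W. geom_bound L (real h * \<alpha>)))
      \<le> real W * (L + 8 * harm M * (real L * W / q + W + q))"
    by (intro mult_left_mono) auto
  with mean_square_trig_sum_le[OF assms(1), where L = L and x = \<alpha> and W = W] show ?thesis
    by (rule order_trans)
qed

lemma weighted_mean_square_trig_sum_le:
  assumes b_le: "\<And>w. cmod (b w) \<le> 1" and M_ge: "2 * q \<le> M" "W \<le> M"
    and UW_bounds: "U * W \<le> N" "U \<ge> 1"
  shows "(\<Sum>l=1..R*(2*U). real l * (cmod (trig_sum b W (real l * \<alpha>)))\<^sup>2)
    \<le> (6 * harm M)\<^sup>2 * (real R * N * (real R * N / q + (real R * U + real N / U) + q))"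
proof -
  define L where "L = R * (2 * U)"
  define A B C where "A = real R * U" and "B = real R * N / q" and "C = real N / U"
  have nonneg: "0 \<le> A" "0 \<le> B" "0 \<le> C" by (simp_all add: A_def B_def C_def)
  have harm_ge_1: "1 \<le> (harm M :: real)" using M_ge(1) by (rule one_le_harm_if_q_le)
  have UW_le: "real U * real W \<le> real N" using UW_bounds(1) by (metis of_nat_le_iff of_nat_mult)
  hence W_le: "real W \<le> C" using UW_bounds(2) by (simp add: C_def field_simps)
  have LW_le: "real L * W \<le> 2 * (real R * N)"
    using mult_left_mono[OF UW_le, of "2 * real R"] by (simp add: L_def mult_ac)
  have "real L * W / q \<le> 2 * B"
    using divide_right_mono[OF LW_le, of "real q"] by (simp add: B_def)
  hence "8 * harm M * (real L * W / q + W + q) \<le> 8 * harm M * (2 * B + C + q)"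
    using W_le harm_ge_1 by (intro mult_left_mono) auto
  moreover have "real L \<le> 8 * harm M * (2 * A)"
    using mult_right_mono[of 1 "8 * harm M" "real L"] harm_ge_1 by (simp add: L_def A_def mult_ac)
  ultimately have "real L + 8 * harm M * (real L * W / q + W + q)
      \<le> 8 * harm M * (2 * A + (2 * B + C + q))"
    unfolding distrib_left[of "8 * harm M" "2 * A"] by linarith
  also have "\<dots> \<le> 8 * harm M * (2 * (B + (A + C) + q))"
    using harm_ge_1 nonneg by (intro mult_left_mono) auto
  finally have L_le: "real L + 8 * harm M * (real L * W / q + W + q)
      \<le> 8 * harm M * (2 * (B + (A + C) + q))" .
  have "(\<Sum>l=1..L. real l * (cmod (trig_sum b W (real l * \<alpha>)))\<^sup>2)
      \<le> real L * (\<Sum>l=1..L. (cmod (trig_sum b W (real l * \<alpha>)))\<^sup>2)"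
    unfolding sum_distrib_left by (intro sum_mono mult_right_mono) auto
  also have "\<dots> \<le> real L * (real W * (L + 8 * harm M * (real L * W / q + W + q)))"
    using b_le M_ge by (intro mult_left_mono mean_square_trig_sum_multiples_le) auto
  also have "\<dots> \<le> real L * (real W * (8 * harm M * (2 * (B + (A + C) + q))))"
    by (intro mult_left_mono L_le) auto
  also have "\<dots> = (real L * W) * 1 * (8 * harm M * (2 * (B + (A + C) + q)))"
    by (simp only: mult.assoc mult_1)
  also have "\<dots> \<le> (2 * (real R * N)) * harm M * (8 * harm M * (2 * (B + (A + C) + q)))"
    using harm_ge_1 nonneg by (intro mult_right_mono mult_mono[OF LW_le harm_ge_1]) auto
  also have "\<dots> = 32 * ((harm M)\<^sup>2 * (real R * N * (B + (A + C) + q)))"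
    by (simp add: power2_eq_square)
  also have "\<dots> \<le> 36 * ((harm M)\<^sup>2 * (real R * N * (B + (A + C) + q)))"
    using nonneg by (intro mult_right_mono) auto
  finally show ?thesis
    by (simp add: L_def A_def B_def C_def power_mult_distrib)
qed

lemma bilinear_bound_phase:
  assumes M_ge: "2 * q \<le> M" "R * (2 * U) \<le> M" "W \<le> M" and UW_bounds: "U * W \<le> N" "U \<ge> 1"
  shows "bilinear_bound {1..R} {U..<2*U} {1..W} (\<lambda>r u w. phase r (u * w))
     (6 * harm M ^ 3 * error_term R N (real R * U + real N / U))"
proof (rule bilinear_boundI)
  fix a b :: "nat \<Rightarrow> complex"
  assume a_le: "\<And>u. cmod (a u) \<le> 1" and b_le: "\<And>w. cmod (b w) \<le> 1"
  define s where "s l = cmod (trig_sum b W (real l * \<alpha>))" for l :: nat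
  have "(\<Sum>r=1..R. cmod (\<Sum>u\<in>{U..<2*U}. \<Sum>w=1..W. a u * b w * phase r (u * w)))
     \<le> (\<Sum>r=1..R. \<Sum>u\<in>{U..<2*U}. s (r * u))"
  proof (intro sum_mono sum_norm_le)
    fix r u :: nat
    have "(\<Sum>w=1..W. a u * b w * phase r (u * w)) = a u * trig_sum b W (real (r * u) * \<alpha>)"
      by (simp add: trig_sum_def phase_def sum_distrib_left mult_ac)
    thus "cmod (\<Sum>w=1..W. a u * b w * phase r (u * w)) \<le> s (r * u)"
      using mult_right_mono[OF a_le, of "s (r * u)" u] by (simp only: norm_mult s_def) simp
  qed
  also have "\<dots> \<le> (\<Sum>r=1..R. \<Sum>u=1..2*U. s (r * u))"
    using UW_bounds(2) by (intro sum_mono sum_mono2) (auto simp: s_def)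
  also have "\<dots> \<le> (harm (R * (2 * U)))\<^sup>2 * sqrt (\<Sum>l=1..R*(2*U). real l * (s l)\<^sup>2)"
    by (rule sum_products_le_mean_square) (simp add: s_def)
  also have "\<dots> \<le> (harm M)\<^sup>2 * (6 * harm M * error_term R N (real R * U + real N / U))"
  proof (intro mult_mono power_mono harm_mono M_ge(2))
    show "sqrt (\<Sum>l=1..R*(2*U). real l * (s l)\<^sup>2)
        \<le> 6 * harm M * error_term R N (real R * U + real N / U)"
      unfolding s_def error_term_def
      using weighted_mean_square_trig_sum_le[OF b_le M_ge(1,3) UW_bounds]
      by (intro sqrt_le_mult_sqrt) (auto simp: harm_nonneg)
  qed (auto simp: harm_nonneg intro: sum_nonneg)
  finally show "(\<Sum>r=1..R. cmod (\<Sum>u\<in>{U..<2*U}. \<Sum>w=1..W. a u * b w * phase r (u * w)))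
     \<le> 6 * harm M ^ 3 * error_term R N (real R * U + real N / U)"
    by (simp add: power2_eq_square power3_eq_cube mult_ac)
qed

lemma bilinear_bound_hyperbola:
  fixes f g :: "nat \<Rightarrow> nat"
  assumes M_ge: "2 * q \<le> M" "8 * N\<^sup>2 \<le> M" and "R \<le> N" and U_bounds: "1 \<le> U" "U \<le> N"
    and f_le: "\<And>u. f u \<le> N" and g_le: "\<And>w. g w \<le> N"
  shows "bilinear_bound {1..R} {U..<2*U} {1..N div U}
     (\<lambda>r u w. of_bool (f u \<le> g w) * (of_bool (u \<le> N div w) * phase r (u * w)))
     (24 * harm M ^ 5 * error_term R N (real R * U + real N / U))"
proof -
  define E where "E = 6 * harm M ^ 3 * error_term R N (real R * U + real N / U)"
  define Q where "Q = 2 * N + 1"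
  have "N \<le> N\<^sup>2" by (simp add: power2_eq_square)
  have "R * (2 * U) \<le> N * (2 * N)" using assms by (intro mult_le_mono) auto
  hence RU_le: "R * (2 * U) \<le> M" using M_ge(2) by (simp add: power2_eq_square)
  have phase_bound: "bilinear_bound {1..R} {U..<2*U} {1..N div U} (\<lambda>r u w. phase r (u * w)) E"
    unfolding E_def
  proof (rule bilinear_bound_phase[OF M_ge(1) RU_le])
    show "N div U \<le> M" using div_le_dividend[of N U] \<open>N \<le> N\<^sup>2\<close> M_ge(2) by linarith
  qed (use U_bounds in auto)
  have "bilinear_bound {1..R} {U..<2*U} {1..N div U}
     (\<lambda>r u w. of_bool (u \<le> N div w) * phase r (u * w)) ((1 + harm (2 * Q)) * E)"
  proof (rule separation_of_variables[OF phase_bound])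
    show "u < Q" if "u \<in> {U..<2*U}" for u using that U_bounds by (auto simp: Q_def)
    show "N div w < Q" for w using div_le_dividend[of N w] unfolding Q_def by linarith
  qed (simp add: Q_def)
  hence "bilinear_bound {1..R} {U..<2*U} {1..N div U}
     (\<lambda>r u w. of_bool (f u \<le> g w) * (of_bool (u \<le> N div w) * phase r (u * w)))
     ((1 + harm (2 * Q)) * ((1 + harm (2 * Q)) * E))"
  proof (rule separation_of_variables)
    show "f u < Q" "g u < Q" for u using f_le[of u] g_le[of u] by (auto simp: Q_def)
  qed (simp add: Q_def)
  thus ?thesis
  proof (rule bilinear_bound_mono)
    have "2 * Q \<le> M" using U_bounds \<open>N \<le> N\<^sup>2\<close> M_ge(2) by (simp add: Q_def)
    hence "1 + harm (2 * Q) \<le> 2 * (harm M :: real)"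
      using harm_mono[of "2 * Q" M, where ?'a = real] one_le_harm_if_q_le[OF M_ge(1)] by simp
    hence "(1 + harm (2 * Q)) * ((1 + harm (2 * Q)) * E) \<le> 2 * harm M * (2 * harm M * E)"
      using bilinear_bound_nonneg[OF phase_bound] by (intro mult_mono) (auto simp: harm_nonneg)
    thus "(1 + harm (2 * Q)) * ((1 + harm (2 * Q)) * E)
        \<le> 24 * harm M ^ 5 * error_term R N (real R * U + real N / U)"
      by (simp add: E_def power_numeral_reduce mult_ac)
  qed
qed

lemma dyadic_block_le:
  fixes f g :: "nat \<Rightarrow> nat"
  assumes M_ge: "2 * q \<le> M" "8 * N\<^sup>2 \<le> M" and "R \<le> N" and U_bounds: "1 \<le> U" "U \<le> N"
    and f_le: "\<And>u. f u \<le> N" and g_le: "\<And>w. g w \<le> N" and "X > 0" "Y \<ge> 0"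
    and b_bounds: "\<And>u. cmod (b u) \<le> 1" "\<And>u. b u \<noteq> 0 \<Longrightarrow> X < real u \<and> real u \<le> Y"
    and c_le: "\<And>w. cmod (c w) \<le> 1"
  shows "(\<Sum>r=1..R. cmod (\<Sum>u\<in>{U..<2*U}. \<Sum>w=1..N div U. b u * c w *
        (of_bool (f u \<le> g w) * (of_bool (u \<le> N div w) * phase r (u * w)))))
     \<le> 24 * harm M ^ 5 * error_term R N (real R * Y + 2 * real N / X)"
    (is "?lhs \<le> _")
proof (cases "\<exists>u\<in>{U..<2*U}. b u \<noteq> 0")
  case False
  hence "?lhs = 0" by (intro sum.neutral ballI) simp
  thus ?thesis
    using \<open>X > 0\<close> \<open>Y \<ge> 0\<close> by (simp add: harm_nonneg error_term_nonneg)
next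
  case True
  then obtain u where "U \<le> u" "u < 2 * U" "X < real u" "real u \<le> Y"
    using b_bounds(2) by auto
  hence "real U \<le> Y" and "X \<le> 2 * real U" by linarith+
  hence "real R * U \<le> real R * Y" "real N * X \<le> real N * (2 * real U)"
    by (intro mult_left_mono; simp)+
  hence "real R * U + real N / U \<le> real R * Y + 2 * real N / X"
    using \<open>X > 0\<close> U_bounds(1) by (intro add_mono) (simp_all add: field_simps)
  hence "24 * harm M ^ 5 * error_term R N (real R * U + real N / U)
      \<le> 24 * harm M ^ 5 * error_term R N (real R * Y + 2 * real N / X)"
    by (intro mult_left_mono error_term_mono) (auto simp: harm_nonneg)
  moreover have "?lhs \<le> 24 * harm M ^ 5 * error_term R N (real R * U + real N / U)"
    using bilinear_bound_hyperbola[OF M_ge \<open>R \<le> N\<close> U_bounds f_le g_le] b_bounds(1) c_le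
    by (rule bilinear_boundD)
  ultimately show ?thesis by linarith
qed

lemma typeII_sum_le:
  fixes f g :: "nat \<Rightarrow> nat"
  assumes M_ge: "2 * q \<le> M" "8 * N\<^sup>2 \<le> M" and RN_bounds: "R \<le> N" "1 \<le> N"
    and f_le: "\<And>u. f u \<le> N" and g_le: "\<And>w. g w \<le> N" and X_pos: "X > 0" and Y_nonneg: "Y \<ge> 0"
    and b_bounds: "\<And>u. cmod (b u) \<le> 1" "\<And>u. b u \<noteq> 0 \<Longrightarrow> X < real u \<and> real u \<le> Y"
    and c_le: "\<And>w. cmod (c w) \<le> 1"
  shows "(\<Sum>r=1..R. cmod (\<Sum>u=1..N. b u *
        (\<Sum>w=1..N div u. c w * (of_bool (f u \<le> g w) * phase r (u * w)))))
     \<le> 24 * harm M ^ 6 * error_term R N (real R * Y + 2 * real N / X)"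
    (is "?lhs \<le> _")
proof -
  define E where "E = 24 * harm M ^ 5 * error_term R N (real R * Y + 2 * real N / X)"
  have "0 \<le> E" using X_pos Y_nonneg by (simp add: E_def harm_nonneg error_term_nonneg)
  obtain k where k_bounds: "2 ^ k \<le> N" "N < 2 ^ Suc k"
    using ex_power_ivl1[of 2 N] RN_bounds by auto
  define T where "T i r = (\<Sum>u\<in>{2^i..<2*2^i}. \<Sum>w=1..N div 2^i. b u * c w *
        (of_bool (f u \<le> g w) * (of_bool (u \<le> N div w) * phase r (u * w))))" for i r
  have block_le: "(\<Sum>r=1..R. cmod (T i r)) \<le> E" if "i < Suc k" for i
    unfolding T_def E_def
  proof (rule dyadic_block_le[OF M_ge RN_bounds(1) _ _ f_le g_le X_pos Y_nonneg b_bounds c_le])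
    have "(2::nat) ^ i \<le> 2 ^ k" using that by (intro power_increasing) auto
    thus "2 ^ i \<le> N" using k_bounds(1) by linarith
  qed simp
  have "?lhs = (\<Sum>r=1..R. cmod (\<Sum>i<Suc k. T i r))"
    unfolding sum_distrib_left sum_hyperbola_dyadic[OF k_bounds(2)] T_def
    by (simp add: mult_ac del: sum.lessThan_Suc)
  also have "\<dots> \<le> (\<Sum>r=1..R. \<Sum>i<Suc k. cmod (T i r))"
    by (intro sum_mono norm_sum)
  also have "\<dots> = (\<Sum>i<Suc k. \<Sum>r=1..R. cmod (T i r))"
    by (rule sum.swap)
  also have "\<dots> \<le> (\<Sum>i<Suc k. E)"
    by (intro sum_mono block_le) auto
  also have "\<dots> = real (Suc k) * E"
    by simp
  also have "\<dots> \<le> harm M * E"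
    using Suc_le_harm[OF k_bounds(1) M_ge(2)] \<open>0 \<le> E\<close> by (rule mult_right_mono)
  finally show ?thesis by (simp add: E_def power_numeral_reduce mult_ac)
qed

end

section \<open>Sifted exponential sums\<close>

locale sifted_sum = rational_approx \<alpha> \<beta> a q + prime_sieve P N
  for \<alpha> \<beta> :: real and a :: int and q :: nat and P :: "nat set" and N :: nat +
  fixes R M :: nat and X :: real
  assumes R_le: "R \<le> N" and N_ge_1: "1 \<le> N" and q_le_M: "2 * q \<le> M" and N_le_M: "8 * N\<^sup>2 \<le> M"
    and X_ge_1: "1 \<le> X" and P_le: "\<And>p. p \<in> P \<Longrightarrow> real p \<le> X\<^sup>2" and two_notin_P: "2 \<notin> P"
begin

definition main_term :: real where
  "main_term = error_term R N (real R * X\<^sup>2 + 2 * real N / X)"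

definition summand :: "nat \<Rightarrow> nat \<Rightarrow> complex" where
  "summand r n = of_bool (n mod 4 = 1) * phase r n"

definition typeI_part :: "nat \<Rightarrow> complex" where
  "typeI_part r = (\<Sum>d=1..N. of_bool (real d \<le> X) * sieve_mu d * (\<Sum>m=1..N div d. summand r (d * m)))"

definition typeII_part :: "nat \<Rightarrow> complex" where
  "typeII_part r = (\<Sum>u=1..N. typeII_coeff X u *
     (\<Sum>w=1..N div u. of_bool (least_sieve_prime u \<le> least_sieve_prime w) * summand r (u * w)))"

lemma typeI_part_le: "(\<Sum>r=1..R. cmod (typeI_part r)) \<le> 4 * harm M ^ 6 * main_term"
proof -
  define Y where "Y = min N (nat \<lfloor>X\<rfloor>)"
  define c where "c d = of_bool (d \<le> N \<and> real d \<le> X) * sieve_mu d" for d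
  have harm_ge_1: "1 \<le> (harm M :: real)" using q_le_M by (rule one_le_harm_if_q_le)
  have "(\<Sum>r=1..R. cmod (typeI_part r)) = (\<Sum>r=1..R. cmod (\<Sum>d=1..N. c d *
        (\<Sum>m=1..N div d. of_bool ((d * m) mod 4 = 1) * phase r (d * m))))"
    unfolding typeI_part_def summand_def c_def by (intro sum.cong refl arg_cong[of _ _ cmod]) auto
  also have "\<dots> \<le> 4 * harm M ^ 3 * error_term R N (real R * Y)"
  proof (rule typeI_sum_le)
    show "cmod (c d) \<le> 1" for d using norm_sieve_mu_le[of d] by (simp add: c_def norm_mult)
    show "odd d \<and> d \<le> Y" if "c d \<noteq> 0" for d
      using that two_notin_P
      by (auto simp: c_def Y_def le_nat_iff le_floor_iff odd_if_sieve_mu_nonzero)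
    have "R * Y \<le> N * N" using R_le by (intro mult_le_mono) (auto simp: Y_def)
    thus "4 * (R * Y) \<le> M" using N_le_M by (simp add: power2_eq_square)
  qed (rule q_le_M)
  also have "\<dots> \<le> 4 * harm M ^ 6 * main_term"
    unfolding main_term_def
  proof (intro mult_mono error_term_mono mult_left_mono power_increasing harm_ge_1)
    have "real Y \<le> X" using X_ge_1 unfolding Y_def by linarith
    also have "X \<le> X\<^sup>2" using X_ge_1 by (simp add: power2_eq_square)
    finally have "real R * Y \<le> real R * X\<^sup>2" by (rule mult_left_mono) simp
    thus "real R * Y \<le> real R * X\<^sup>2 + 2 * real N / X" using X_ge_1 by (simp add: add_increasing2)
  qed (use harm_ge_1 in \<open>auto simp: error_term_nonneg\<close>)
  finally show ?thesis .
qed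

definition typeII_residue_coeff :: "nat \<Rightarrow> nat \<Rightarrow> complex" where
  "typeII_residue_coeff c u = typeII_coeff X u * of_bool (u mod 4 = c)"

definition typeII_residue_sum :: "nat \<Rightarrow> nat \<Rightarrow> complex" where
  "typeII_residue_sum c r = (\<Sum>u=1..N. typeII_residue_coeff c u *
     (\<Sum>w=1..N div u. of_bool (w mod 4 = c) *
       (of_bool (least_sieve_prime u \<le> least_sieve_prime w) * phase r (u * w))))"

lemma typeII_coeff_mod_4:
  "typeII_coeff X u * of_bool ((u * w) mod 4 = 1)
    = (\<Sum>c\<in>{1, 3}. typeII_residue_coeff c u * of_bool (w mod 4 = c))"
proof (cases "typeII_coeff X u = 0")
  case False
  hence "sieve_mu u \<noteq> 0" by (auto simp: typeII_coeff_def split: if_splits)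
  hence odd: "odd u" using two_notin_P by (rule odd_if_sieve_mu_nonzero)
  hence "u mod 4 = 1 \<or> u mod 4 = 3" by presburger
  thus ?thesis unfolding mult_mod_4_eq_1_iff[OF odd] by (auto simp: typeII_residue_coeff_def)
qed (simp add: typeII_residue_coeff_def)

lemma typeII_part_eq: "typeII_part r = (\<Sum>c\<in>{1, 3}. typeII_residue_sum c r)"
proof -
  define F where "F u w = of_bool (least_sieve_prime u \<le> least_sieve_prime w) * phase r (u * w)"
    for u w
  have "typeII_part r = (\<Sum>u=1..N. \<Sum>w=1..N div u.
      typeII_coeff X u * of_bool ((u * w) mod 4 = 1) * F u w)"
    by (simp only: typeII_part_def summand_def F_def sum_distrib_left mult_ac)
  also have "\<dots> = (\<Sum>u=1..N. \<Sum>w=1..N div u. \<Sum>c\<in>{1, 3}.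
      typeII_residue_coeff c u * (of_bool (w mod 4 = c) * F u w))"
    by (simp only: typeII_coeff_mod_4 sum_distrib_right mult.assoc)
  also have "\<dots> = (\<Sum>u=1..N. \<Sum>c\<in>{1, 3}. \<Sum>w=1..N div u.
      typeII_residue_coeff c u * (of_bool (w mod 4 = c) * F u w))"
    by (intro sum.cong refl sum.swap)
  also have "\<dots> = (\<Sum>c\<in>{1, 3}. \<Sum>u=1..N. \<Sum>w=1..N div u.
      typeII_residue_coeff c u * (of_bool (w mod 4 = c) * F u w))"
    by (rule sum.swap)
  finally show ?thesis
    by (simp only: typeII_residue_sum_def F_def sum_distrib_left)
qed

lemma typeII_residue_sum_le:
  "(\<Sum>r=1..R. cmod (typeII_residue_sum c r)) \<le> 24 * harm M ^ 6 * main_term"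
  unfolding typeII_residue_sum_def main_term_def
proof (rule typeII_sum_le[OF q_le_M N_le_M R_le N_ge_1 least_sieve_prime_le_bound
      least_sieve_prime_le_bound])
  show "cmod (typeII_residue_coeff c u) \<le> 1" for u
    using norm_typeII_coeff_le[of X u] by (simp add: typeII_residue_coeff_def norm_mult)
  show "X < real u \<and> real u \<le> X\<^sup>2" if "typeII_residue_coeff c u \<noteq> 0" for u
    using that typeII_coeff_support[OF _ X_ge_1 P_le, of u] by (auto simp: typeII_residue_coeff_def)
qed (use X_ge_1 in auto)

lemma typeII_part_le: "(\<Sum>r=1..R. cmod (typeII_part r)) \<le> 48 * harm M ^ 6 * main_term"
proof -
  have "(\<Sum>r=1..R. cmod (typeII_part r)) \<le> (\<Sum>r=1..R. \<Sum>c\<in>{1, 3}. cmod (typeII_residue_sum c r))"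
    unfolding typeII_part_eq by (intro sum_mono norm_sum)
  also have "\<dots> = (\<Sum>c\<in>{1, 3}. \<Sum>r=1..R. cmod (typeII_residue_sum c r))"
    by (rule sum.swap)
  also have "\<dots> \<le> (\<Sum>c\<in>{1, 3 :: nat}. 24 * harm M ^ 6 * main_term)"
    by (intro sum_mono typeII_residue_sum_le)
  finally show ?thesis by simp
qed

lemma sum_norm_sifted_le:
  "(\<Sum>r=1..R. cmod (\<Sum>n=1..N. of_bool (prime_factors n \<inter> P = {}) * summand r n))
    \<le> 52 * harm M ^ 6 * main_term"
proof -
  have "(\<Sum>r=1..R. cmod (\<Sum>n=1..N. of_bool (prime_factors n \<inter> P = {}) * summand r n))
      \<le> (\<Sum>r=1..R. cmod (typeI_part r) + cmod (typeII_part r))"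
    unfolding sum_sifted_eq[OF X_ge_1] typeI_part_def typeII_part_def
    by (intro sum_mono norm_triangle_ineq)
  also have "\<dots> \<le> 4 * harm M ^ 6 * main_term + 48 * harm M ^ 6 * main_term"
    unfolding sum.distrib by (intro add_mono typeI_part_le typeII_part_le)
  finally show ?thesis by (simp add: algebra_simps)
qed

end

lemma positive_nats_le_eq: "{n. 0 < n \<and> real n \<le> x} = {1..nat \<lfloor>x\<rfloor>}"
  by (auto simp: Suc_le_eq) linarith+

lemma S_sum_eq_sifted:
  "S_sum x N = (\<Sum>n=1..nat \<lfloor>N\<rfloor>. of_bool (prime_factors n \<inter> sieve_primes (nat \<lfloor>N\<rfloor>) = {}) *
     (of_bool (n mod 4 = 1) * e_char (real n * x)))"
  unfolding S_sum_def positive_nats_le_eq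
  by (intro sum.cong refl) (auto simp: b_char_def BB_iff_sifted[where N = "nat \<lfloor>N\<rfloor>"])

lemma norm_S_sum_le:
  assumes "N \<ge> 0"
  shows "cmod (S_sum x N) \<le> N"
proof -
  have "cmod (S_sum x N) \<le> (\<Sum>n=1..nat \<lfloor>N\<rfloor>. 1)"
    unfolding S_sum_def positive_nats_le_eq by (intro sum_norm_le) (simp add: norm_mult b_char_def)
  thus ?thesis using assms by simp linarith
qed

section \<open>Choice of the cutoff\<close>

definition error_factor :: "real \<Rightarrow> real \<Rightarrow> real \<Rightarrow> real" where
  "error_factor q N R = 1 / sqrt q + sqrt q / sqrt (R * N)
     + 1 / (R powr (1/3) * N powr (1/6)) + R powr (1/3) / N powr (1/3)"

definition cutoff :: "real \<Rightarrow> real \<Rightarrow> real" where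
  "cutoff N R = (N / R) powr (1/3) + N powr (1/4)"

lemma cutoff_pos: "0 < N \<Longrightarrow> 0 < cutoff N R"
  by (simp add: cutoff_def add_nonneg_pos)

lemma one_le_cutoff: "1 \<le> N \<Longrightarrow> 1 \<le> cutoff N R"
  unfolding cutoff_def using ge_one_powr_ge_zero[of N "1/4"] by (simp add: add_increasing)

lemma le_cutoff_power4:
  assumes "0 < N"
  shows "N \<le> cutoff N R ^ 4"
proof -
  have "N = (N powr (1/4)) ^ 4"
    using assms by (simp add: powr_powr flip: powr_realpow)
  also have "\<dots> \<le> cutoff N R ^ 4"
    by (intro power_mono) (auto simp: cutoff_def)
  finally show ?thesis .
qed

lemma cutoff_div_sqrt_le:
  assumes "0 < N" "0 < R"
  defines "s \<equiv> 1 / (R powr (1/3) * N powr (1/6))" and "t \<equiv> R powr (1/3) / N powr (1/3)"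
  shows "cutoff N R / sqrt N \<le> s + (s + t) / 2"
proof -
  have sqrt_eq: "sqrt N = N powr (1/3) * N powr (1/6)" "sqrt N = N powr (1/4) * N powr (1/4)"
    using assms by (simp_all add: powr_half_sqrt flip: powr_add)
  have "(N / R) powr (1/3) / sqrt N = s"
    using assms by (simp add: s_def sqrt_eq(1) powr_divide)
  moreover have "N powr (1/4) / sqrt N \<le> (s + t) / 2"
  proof -
    have "s * t = 1 / sqrt N"
      using assms by (simp add: s_def t_def sqrt_eq(1))
    hence "sqrt (s * t) = N powr (1/4) / sqrt N"
      using assms unfolding sqrt_eq(2) by (simp add: real_sqrt_divide)
    thus ?thesis
      using arith_geo_mean_sqrt[of s t] by (simp add: s_def t_def)
  qed
  ultimately show ?thesis by (simp add: cutoff_def add_divide_distrib)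
qed

lemma inverse_sqrt_cutoff_le:
  assumes "0 < N" "0 < R"
  shows "1 / sqrt (R * cutoff N R) \<le> 1 / (R powr (1/3) * N powr (1/6))"
proof -
  have "(R powr (1/3) * N powr (1/6))\<^sup>2 = R powr (2/3) * N powr (1/3)"
    using assms by (simp add: power_mult_distrib powr_powr flip: powr_realpow)
  also have "\<dots> = R * (N / R) powr (1/3)"
    using assms powr_add[of R "2/3" "1/3"] by (simp add: powr_divide field_simps)
  also have "\<dots> \<le> R * cutoff N R"
    using assms by (simp add: cutoff_def)
  finally have "R powr (1/3) * N powr (1/6) \<le> sqrt (R * cutoff N R)"
    by (rule real_le_rsqrt)
  thus ?thesis
    using assms cutoff_pos[OF assms(1)] by (intro divide_left_mono mult_pos_pos) auto
qed

lemma sqrt_sum4_le: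
  assumes "0 \<le> a" "0 \<le> b" "0 \<le> c" "0 \<le> d"
  shows "sqrt (a + b + c + d) \<le> sqrt a + sqrt b + sqrt c + sqrt d"
  using sqrt_add_le_add_sqrt[of "a + b + c" d] sqrt_add_le_add_sqrt[of "a + b" c]
    sqrt_add_le_add_sqrt[of a b] assms
  by linarith

lemma sqrt_cutoff_terms_le:
  fixes q N R :: real
  assumes "0 < q" "0 < N" "0 < R"
  defines "X \<equiv> cutoff N R"
  shows "sqrt (1 / q + X\<^sup>2 / N + 2 / (R * X) + q / (R * N)) \<le> 3 * error_factor q N R"
proof -
  define s t where "s = 1 / (R powr (1/3) * N powr (1/6))" and "t = R powr (1/3) / N powr (1/3)"
  have "X > 0" using assms by (simp add: X_def cutoff_pos)
  have "sqrt (1 / q + X\<^sup>2 / N + 2 / (R * X) + q / (R * N))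
      \<le> sqrt (1 / q) + sqrt (X\<^sup>2 / N) + sqrt (2 / (R * X)) + sqrt (q / (R * N))"
    using assms \<open>X > 0\<close> by (intro sqrt_sum4_le) auto
  also have "\<dots> = 1 / sqrt q + X / sqrt N + sqrt 2 * (1 / sqrt (R * X)) + sqrt q / sqrt (R * N)"
    using \<open>X > 0\<close> by (simp add: real_sqrt_divide)
  also have "\<dots> \<le> 1 / sqrt q + (s + (s + t) / 2) + 3 / 2 * s + sqrt q / sqrt (R * N)"
  proof (intro add_mono order.refl mult_mono)
    show "X / sqrt N \<le> s + (s + t) / 2"
      unfolding X_def s_def t_def using assms by (intro cutoff_div_sqrt_le) auto
    show "1 / sqrt (R * X) \<le> s"
      unfolding X_def s_def using assms by (intro inverse_sqrt_cutoff_le) auto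
    show "sqrt 2 \<le> 3 / 2" by (rule real_le_lsqrt) (auto simp: power2_eq_square)
  qed (use assms \<open>X > 0\<close> in auto)
  also have "\<dots> \<le> 3 * error_factor q N R"
  proof -
    have "0 \<le> t" "0 \<le> 1 / sqrt q" "0 \<le> sqrt q / sqrt (R * N)"
      using assms by (auto simp: t_def)
    moreover have "error_factor q N R = 1 / sqrt q + sqrt q / sqrt (R * N) + s + t"
      by (simp add: error_factor_def s_def t_def)
    ultimately show ?thesis unfolding add_divide_distrib by linarith
  qed
  finally show ?thesis .
qed

lemma (in rational_approx) error_term_cutoff_le:
  assumes "1 \<le> N" "0 < R" "real n \<le> N" "real r \<le> R"
  defines "X \<equiv> cutoff N R"
  shows "error_term r n (real r * X\<^sup>2 + 2 * real n / X) \<le> 3 * (R * N * error_factor q N R)"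
proof -
  have pos: "X > 0" "real q > 0" using assms q_ge_1 by (auto simp: X_def cutoff_pos)
  have "error_term r n (real r * X\<^sup>2 + 2 * real n / X)
      \<le> sqrt (R * N * (R * N / q + (R * X\<^sup>2 + 2 * N / X) + q))"
    unfolding error_term_def using assms pos
    by (intro real_sqrt_le_mono mult_mono add_mono divide_right_mono order.refl) auto
  also have "R * N * (R * N / q + (R * X\<^sup>2 + 2 * N / X) + q)
      = (R * N)\<^sup>2 * (1 / q + X\<^sup>2 / N + 2 / (R * X) + q / (R * N))"
    using assms(1,2) pos by (simp add: field_simps power2_eq_square)
  also have "sqrt \<dots> = R * N * sqrt (1 / q + X\<^sup>2 / N + 2 / (R * X) + q / (R * N))"
    using assms(1,2) by (simp add: real_sqrt_mult)
  also have "\<dots> \<le> R * N * (3 * error_factor q N R)"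
    unfolding X_def using assms(1,2) pos by (intro mult_left_mono sqrt_cutoff_terms_le) auto
  finally show ?thesis by simp
qed

lemma one_le_error_factor:
  assumes "0 < N" "0 < R" "0 \<le> q" "N \<le> R \<or> R * N \<le> q"
  shows "1 \<le> error_factor q N R"
proof -
  have nonneg: "0 \<le> 1 / sqrt q" "0 \<le> sqrt q / sqrt (R * N)"
    "0 \<le> 1 / (R powr (1/3) * N powr (1/6))" "0 \<le> R powr (1/3) / N powr (1/3)"
    using assms by auto
  from assms(4) have "1 \<le> sqrt q / sqrt (R * N) \<or> 1 \<le> R powr (1/3) / N powr (1/3)"
  proof
    assume "N \<le> R"
    hence "N powr (1/3) \<le> R powr (1/3)" using assms by (intro powr_mono2) auto
    thus ?thesis using assms by simp
  qed (use assms in simp)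
  thus ?thesis
    unfolding error_factor_def using nonneg by linarith
qed

section \<open>Logarithms\<close>

lemma harm_le_one_plus_ln: "n \<ge> 1 \<Longrightarrow> harm n \<le> 1 + ln (real n)"
  using euler_mascheroni_sequence_decreasing[of 1 n] by (simp add: harm_expand)

lemma one_plus_ln_power_le:
  fixes y \<epsilon> :: real
  assumes "1 \<le> y" "0 < \<epsilon>" "0 < k"
  shows "(1 + ln y) ^ k \<le> (1 + real k / \<epsilon>) ^ k * y powr \<epsilon>"
proof -
  define \<delta> where "\<delta> = \<epsilon> / real k"
  have "\<delta> > 0" using assms by (simp add: \<delta>_def)
  have "1 + ln y \<le> y powr \<delta> + y powr \<delta> / \<delta>"
    using ln_powr_bound[of y \<delta>] ge_one_powr_ge_zero[of y \<delta>] assms \<open>\<delta> > 0\<close> by (intro add_mono) auto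
  also have "\<dots> = (1 + real k / \<epsilon>) * y powr \<delta>"
    by (simp add: \<delta>_def algebra_simps)
  finally have "(1 + ln y) ^ k \<le> ((1 + real k / \<epsilon>) * y powr \<delta>) ^ k"
    using assms by (intro power_mono) auto
  also have "\<dots> = (1 + real k / \<epsilon>) ^ k * y powr \<epsilon>"
    using assms by (simp add: power_mult_distrib powr_powr \<delta>_def flip: powr_realpow)
  finally show ?thesis .
qed

lemma log_power_le_powr:
  fixes \<epsilon> :: real
  assumes "\<epsilon> > 0"
  obtains K :: real where "K > 0"
    "\<And>x. x \<ge> 1 \<Longrightarrow> (1 + ln (8 * x\<^sup>2)) ^ 6 * sqrt (ln x) \<le> K * x powr \<epsilon>"
proof
  define K where "K = (1 + real 7 / (\<epsilon> / 2)) ^ 7 * 8 powr (\<epsilon> / 2)"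
  show "K > 0" using assms by (simp add: K_def add_pos_nonneg)
  fix x :: real assume x: "x \<ge> 1"
  have one_le: "1 \<le> 8 * x\<^sup>2" using x one_le_power[of x 2] by linarith
  have "ln x \<le> ln (8 * x\<^sup>2)"
    using x self_le_power[of x 2] by (intro ln_mono) auto
  moreover have "2 * sqrt (ln x) \<le> 1 + ln x"
    using arith_geo_mean_sqrt[of 1 "ln x"] x by simp
  ultimately have "sqrt (ln x) \<le> 1 + ln (8 * x\<^sup>2)"
    using ln_ge_zero[OF x] by linarith
  hence "(1 + ln (8 * x\<^sup>2)) ^ 6 * sqrt (ln x) \<le> (1 + ln (8 * x\<^sup>2)) ^ 6 * (1 + ln (8 * x\<^sup>2))"
    using one_le by (intro mult_left_mono) auto
  also have "\<dots> = (1 + ln (8 * x\<^sup>2)) ^ 7"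
    by (simp add: power_numeral_reduce)
  also have "\<dots> \<le> (1 + real 7 / (\<epsilon> / 2)) ^ 7 * (8 * x\<^sup>2) powr (\<epsilon> / 2)"
    using one_le assms by (intro one_plus_ln_power_le) auto
  also have "(8 * x\<^sup>2) powr (\<epsilon> / 2) = 8 powr (\<epsilon> / 2) * x powr \<epsilon>"
    using x by (simp add: powr_mult powr_powr flip: powr_numeral)
  finally show "(1 + ln (8 * x\<^sup>2)) ^ 6 * sqrt (ln x) \<le> K * x powr \<epsilon>"
    by (simp add: K_def mult.assoc)
qed

section \<open>The main estimate\<close>

lemma sifted_sum_sieve_primes:
  assumes "rational_approx \<alpha> \<beta> a q" "1 \<le> X" "real N \<le> X ^ 4"
    and "R \<le> N" "1 \<le> N" "2 * q \<le> M" "8 * N\<^sup>2 \<le> M"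
  shows "sifted_sum \<alpha> \<beta> a q (sieve_primes N) N R M X"
proof -
  have "real p \<le> X\<^sup>2" if "p \<in> sieve_primes N" for p
  proof (rule power2_le_imp_le)
    have "p\<^sup>2 \<le> N" using that by (simp add: sieve_primes_def)
    hence "(real p)\<^sup>2 \<le> real N" by (metis of_nat_le_iff of_nat_power)
    also have "\<dots> \<le> (X\<^sup>2)\<^sup>2" using assms(3) by simp
    finally show "(real p)\<^sup>2 \<le> (X\<^sup>2)\<^sup>2" .
  qed simp
  thus ?thesis
    using assms by (intro sifted_sum.intro prime_sieve_sieve_primes sifted_sum_axioms.intro)
      (auto simp: sieve_primes_def)
qed

lemma sum_S_sum_le_trivial:
  assumes "0 \<le> N" "0 \<le> R"
  shows "(\<Sum>r::nat | 0 < r \<and> real r \<le> R. cmod (S_sum (real r * \<alpha>) N)) \<le> R * N"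
proof -
  have "(\<Sum>r=1..nat \<lfloor>R\<rfloor>. cmod (S_sum (real r * \<alpha>) N)) \<le> (\<Sum>r=1..nat \<lfloor>R\<rfloor>. N)"
    using assms by (intro sum_mono norm_S_sum_le)
  also have "\<dots> = real (nat \<lfloor>R\<rfloor>) * N" by simp
  also have "\<dots> \<le> R * N" using assms by (intro mult_right_mono) auto
  finally show ?thesis unfolding positive_nats_le_eq .
qed

context rational_approx
begin

lemma sum_S_sum_le_cutoff:
  assumes N_ge_1: "N \<ge> 1" and R_bounds: "1 \<le> R" "R \<le> N" and q_le: "real q \<le> R * N"
  shows "(\<Sum>r::nat | 0 < r \<and> real r \<le> R. cmod (S_sum (real r * \<alpha>) N))
     \<le> 156 * (1 + ln (8 * N\<^sup>2)) ^ 6 * (R * N * error_factor q N R)"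
proof -
  define n r X where "n = nat \<lfloor>N\<rfloor>" and "r = nat \<lfloor>R\<rfloor>" and "X = cutoff N R"
  have "1 \<le> n" using N_ge_1 by (simp add: n_def le_nat_iff le_floor_iff)
  moreover have "real n \<le> N" "N \<le> real n + 1" using N_ge_1 unfolding n_def by linarith+
  ultimately have n_bounds: "1 \<le> n" "real n \<le> N" "N \<le> 2 * real n" by linarith+
  have r_bounds: "real r \<le> R" "r \<le> n"
    using R_bounds unfolding n_def r_def by (linarith, simp add: nat_mono floor_mono)
  have X_bounds: "1 \<le> X" "real n \<le> X ^ 4"
    using N_ge_1 n_bounds le_cutoff_power4[of N R] by (auto simp: X_def one_le_cutoff)
  have "real q \<le> N * N" using q_le mult_right_mono[OF R_bounds(2), of N] N_ge_1 by linarith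
  also have "\<dots> \<le> (2 * real n) * (2 * real n)" using n_bounds N_ge_1 by (intro mult_mono) auto
  finally have "real q \<le> real (4 * n\<^sup>2)" by (simp add: power2_eq_square)
  hence "2 * q \<le> 8 * n\<^sup>2" unfolding of_nat_le_iff by simp
  then interpret sifted_sum \<alpha> \<beta> a q "sieve_primes n" n r "8 * n\<^sup>2" X
    using X_bounds n_bounds r_bounds rational_approx_axioms by (intro sifted_sum_sieve_primes) auto
  have "(\<Sum>k::nat | 0 < k \<and> real k \<le> R. cmod (S_sum (real k * \<alpha>) N))
      = (\<Sum>k=1..r. cmod (\<Sum>m=1..n. of_bool (prime_factors m \<inter> sieve_primes n = {}) * summand k m))"
    unfolding positive_nats_le_eq S_sum_eq_sifted summand_def phase_def n_def r_def ..
  also have "\<dots> \<le> 52 * harm (8 * n\<^sup>2) ^ 6 * main_term"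
    by (rule sum_norm_sifted_le)
  also have "\<dots> \<le> 52 * (1 + ln (8 * N\<^sup>2)) ^ 6 * (3 * (R * N * error_factor q N R))"
  proof (intro mult_mono power_mono order.refl)
    have "harm (8 * n\<^sup>2) \<le> 1 + ln (real (8 * n\<^sup>2))"
      using n_bounds by (intro harm_le_one_plus_ln) auto
    also have "\<dots> \<le> 1 + ln (8 * N\<^sup>2)" using n_bounds by (simp add: power_mono)
    finally show "harm (8 * n\<^sup>2) \<le> 1 + ln (8 * N\<^sup>2)" .
    show "main_term \<le> 3 * (R * N * error_factor q N R)"
      unfolding main_term_def unfolding X_def
      using N_ge_1 R_bounds n_bounds r_bounds by (intro error_term_cutoff_le) auto
  qed (use X_bounds in \<open>auto simp: harm_nonneg main_term_def error_term_nonneg\<close>)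
  finally show ?thesis by simp
qed

lemma sum_S_sum_le:
  assumes N_ge_1: "N \<ge> 1" and R_ge_1: "R \<ge> 1"
  shows "(\<Sum>r::nat | 0 < r \<and> real r \<le> R. cmod (S_sum (real r * \<alpha>) N))
     \<le> 156 * (1 + ln (8 * N\<^sup>2)) ^ 6 * (R * N * error_factor q N R)"
proof (cases "R \<le> N \<and> real q \<le> R * N")
  case True
  thus ?thesis using N_ge_1 R_ge_1 by (intro sum_S_sum_le_cutoff) auto
next
  case False
  have "1 \<le> N\<^sup>2" using N_ge_1 by (rule one_le_power)
  hence "1 \<le> (1 + ln (8 * N\<^sup>2)) ^ 6" by (intro one_le_power) auto
  hence "1 * (R * N * 1) \<le> 156 * (1 + ln (8 * N\<^sup>2)) ^ 6 * (R * N * error_factor q N R)"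
    using False N_ge_1 R_ge_1 by (intro mult_mono mult_left_mono one_le_error_factor) auto
  with sum_S_sum_le_trivial[of N R \<alpha>] N_ge_1 R_ge_1 show ?thesis by linarith
qed

end

theorem theorem1p8:
  fixes \<epsilon> :: real
  assumes "\<epsilon> > 0"
  shows "\<exists>C>0. \<forall>(\<alpha>::real) (\<beta>::real) (a::int) (q::nat) (N::real) (R::real).
    q \<ge> 1 \<longrightarrow> coprime a (int q) \<longrightarrow> \<alpha> = of_int a / real q + \<beta> \<longrightarrow>
    (real q)\<^sup>2 * \<bar>\<beta>\<bar> \<le> 1 \<longrightarrow> N \<ge> 2 \<longrightarrow> R \<ge> 1 \<longrightarrow>
    (\<Sum>r::nat | 0 < r \<and> real r \<le> R. cmod (S_sum (real r * \<alpha>) N))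
      \<le> C * (R * N / sqrt (ln N)
          * (1 / sqrt (real q) + sqrt (real q) / sqrt (R * N)
             + 1 / (R powr (1/3) * N powr (1/6)) + R powr (1/3) / N powr (1/3))
          * N powr \<epsilon>)"
proof -
  obtain K where "K > 0"
    and K_bound: "\<And>x. x \<ge> 1 \<Longrightarrow> (1 + ln (8 * x\<^sup>2)) ^ 6 * sqrt (ln x) \<le> K * x powr \<epsilon>"
    using log_power_le_powr[OF assms] by blast
  have "(\<Sum>r::nat | 0 < r \<and> real r \<le> R. cmod (S_sum (real r * \<alpha>) N))
      \<le> 156 * K * (R * N / sqrt (ln N) * error_factor q N R * N powr \<epsilon>)"
    if "rational_approx \<alpha> \<beta> a q" "N \<ge> 2" "R \<ge> 1" for \<alpha> \<beta> a q N R
  proof -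
    have "(1 + ln (8 * N\<^sup>2)) ^ 6 \<le> K * N powr \<epsilon> / sqrt (ln N)"
      using K_bound[of N] that(2) by (simp add: le_divide_eq)
    hence "156 * (1 + ln (8 * N\<^sup>2)) ^ 6 * (R * N * error_factor q N R)
        \<le> 156 * (K * N powr \<epsilon> / sqrt (ln N)) * (R * N * error_factor q N R)"
      using that by (intro mult_right_mono mult_left_mono) (auto simp: error_factor_def)
    with rational_approx.sum_S_sum_le[OF that(1), of N R] that show ?thesis
      by (simp add: mult_ac)
  qed
  thus ?thesis
    using \<open>K > 0\<close>
    by (intro exI[of _ "156 * K"]) (auto simp: rational_approx_def error_factor_def)
qed

end
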